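(* Let $S$ be a two-element additively idempotent semiring, and let $n \geq 2$ be an integer. Then the matrix semiring $\mathbf{M}_n(S)$ is finitely based if and only if $S$ is not a distributive lattice.
   Context: An additively idempotent semiring (ai-semiring) is an algebra $(S,+,\cdot)$ with two binary operations such that $(S,+)$ is a commutative idempotent semigroup, $(S,\cdot)$ is a semigroup, and the distributive laws $(x+y)z \approx xz+yz$ and $x(y+z)\approx xy+xz$ hold. No identity elements or zero are assumed, and the signature consists only of the two binary operations $+$ and $\cdot$. For an integer $n\ge 1$ and an ai-semiring $S$, $\mathbf{M}_n(S)$ is the ai-semiring of all $n\times n$ matrices over $S$ under the usual operations: $(A+B)_{ij}=a_{ij}+b_{ij}$ and $(AB)_{ij}=\sum_{k=1}^n a_{ik}b_{kj}$. An identity is a pair $\mathbf{u}\approx\mathbf{v}$ of terms in the signature $\{+,\cdot\}$ over a countably infinite set of variables. It holds in an algebra if both sides take equal values under every assignment of the variables. An algebra is finitely based if the variety it generates can be defined by a finite set of identities, i.e. there is a finite set of identities holding in the algebra from which all identities holding in the algebra follow. "$S$ is a distributive lattice" means that $(S,+,\cdot)$ is a distributive lattice with $+$ as join and $\cdot$ as meet; for two-element $S$ this means that $S$ is isomorphic to $D_2=\{0,1\}$ with $x+y=\max(x,y)$ and $xy=\min(x,y)$. *)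

theory Defs
  imports "Jordan_Normal_Form.Matrix"
begin

section \<open>Terms, identities and equational consequence in the signature of plus and times\<close>

datatype trm = Var nat | Plus trm trm | Times trm trm

type_synonym identity = "trm \<times> trm"

primrec subst :: "(nat \<Rightarrow> trm) \<Rightarrow> trm \<Rightarrow> trm" where
  "subst \<sigma> (Var x) = \<sigma> x"
| "subst \<sigma> (Plus s t) = Plus (subst \<sigma> s) (subst \<sigma> t)"
| "subst \<sigma> (Times s t) = Times (subst \<sigma> s) (subst \<sigma> t)"

text \<open>
  An identity follows from a set \<open>E\<close> of identities if it is derivable from \<open>E\<close> in
  equational logic. No semiring axioms are built in: a finite basis has to entail them too.
\<close>

inductive follows :: "identity set \<Rightarrow> trm \<Rightarrow> trm \<Rightarrow> bool" for E where
  ax: "(u, v) \<in> E \<Longrightarrow> follows E (subst \<sigma> u) (subst \<sigma> v)"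
| refl: "follows E u u"
| sym: "follows E u v \<Longrightarrow> follows E v u"
| trans: "follows E u v \<Longrightarrow> follows E v w \<Longrightarrow> follows E u w"
| plus: "follows E u u' \<Longrightarrow> follows E v v' \<Longrightarrow> follows E (Plus u v) (Plus u' v')"
| times: "follows E u u' \<Longrightarrow> follows E v v' \<Longrightarrow> follows E (Times u v) (Times u' v')"

section \<open>Algebras\<close>

record 'a alg =
  univ :: "'a set"
  add_op :: "'a \<Rightarrow> 'a \<Rightarrow> 'a"
  mul_op :: "'a \<Rightarrow> 'a \<Rightarrow> 'a"

primrec eval :: "'a alg \<Rightarrow> (nat \<Rightarrow> 'a) \<Rightarrow> trm \<Rightarrow> 'a" where
  "eval A \<rho> (Var x) = \<rho> x"
| "eval A \<rho> (Plus s t) = add_op A (eval A \<rho> s) (eval A \<rho> t)"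
| "eval A \<rho> (Times s t) = mul_op A (eval A \<rho> s) (eval A \<rho> t)"

definition holds :: "'a alg \<Rightarrow> trm \<Rightarrow> trm \<Rightarrow> bool" where
  "holds A u v \<longleftrightarrow> (\<forall>\<rho>. range \<rho> \<subseteq> univ A \<longrightarrow> eval A \<rho> u = eval A \<rho> v)"

definition finitely_based :: "'a alg \<Rightarrow> bool" where
  "finitely_based A \<longleftrightarrow>
     (\<exists>E. finite E \<and> (\<forall>(u, v)\<in>E. holds A u v) \<and> (\<forall>u v. holds A u v \<longrightarrow> follows E u v))"

section \<open>Additively idempotent semirings and their matrix semirings\<close>

text \<open>The class \<^class>\<open>semiring\<close> requires neither a zero nor a unit.\<close>

class ai_semiring = semiring +
  assumes add_idem: "x + x = x"

text \<open>
  The order must be supplied to the library's lattice predicate; it is the one that any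
  lattice with join \<open>+\<close> has.
\<close>

definition is_distributive_lattice :: "'a::ai_semiring itself \<Rightarrow> bool" where
  "is_distributive_lattice _ \<longleftrightarrow>
     class.distrib_lattice ((*) :: 'a \<Rightarrow> 'a \<Rightarrow> 'a)
       (\<lambda>x y. x + y = y) (\<lambda>x y. x + y = y \<and> x \<noteq> y) (+)"

text \<open>
  Without a zero, \<^const>\<open>sum\<close> and the product of \<^typ>\<open>'a mat\<close> are not available:
  \<open>nsum f m\<close> is the nonempty sum \<open>f 0 + \<dots> + f m\<close>.
\<close>

primrec nsum :: "(nat \<Rightarrow> 'a::ai_semiring) \<Rightarrow> nat \<Rightarrow> 'a" where
  "nsum f 0 = f 0"
| "nsum f (Suc m) = nsum f m + f (Suc m)"

text \<open>
  The semiring of \<open>n \<times> n\<close> matrices, for \<open>n \<ge> 1\<close>; rows and columns are indexed by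
  \<open>0, \<dots>, n - 1\<close>.
\<close>

definition mat_alg :: "nat \<Rightarrow> 'a::ai_semiring mat alg" where
  "mat_alg n =
     \<lparr>univ = carrier_mat n n,
      add_op = (+),
      mul_op = (\<lambda>A B. mat n n (\<lambda>(i, j). nsum (\<lambda>k. A $$ (i, k) * B $$ (k, j)) (n - 1)))\<rparr>"

end

theory Submission
  imports Defs
begin

text \<open>
  A two-element ai-semiring is \<open>bool\<close> with join as addition and one of the six monotone operations
  as product, so \<open>n \<times> n\<close> matrices become boolean matrices. The value of a term is the join of the
  values of its words.

  If the product is not the meet, few identities determine which words lie below a given term,
  because the value of a word depends only on its first letter, its last letter and the set of
  letters in between.

  If the product is the meet, words are paths in labelled graphs with \<open>n\<close> vertices. Let \<open>L\<close> consist
  of the permutations of \<open>x\<^sub>0 \<dots> x\<^bsub>m-1\<^esub>\<close>, other than this word itself, whose descents are edges of a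
  graph on the positions that is a blow-up of a non-\<open>n\<close>-colourable graph all of whose small
  subgraphs are \<open>n\<close>-colourable. A path \<open>x\<^sub>0 \<dots> x\<^bsub>m-1\<^esub>\<close> colours the positions by vertices; some edge is
  monochromatic together with a position in between, and exchanging the two segments so cut off
  gives a path with label in \<open>L\<close>. Hence \<open>x\<^sub>0 \<dots> x\<^bsub>m-1\<^esub>\<close> lies below the sum of \<open>L\<close>. An identity that holds
  and has only short words cannot derive this: it cuts \<open>x\<^sub>0 \<dots> x\<^bsub>m-1\<^esub>\<close> at few positions, and merging
  these along a proper colouring yields no word of \<open>L\<close>. Words that are not permutations or have
  a wrong descent are separated from \<open>L\<close> by graphs with two vertices.
\<close>

section \<open>Boolean matrices and words\<close>

text \<open>The operation \<open>m\<close> multiplies entries and disjunction adds them. A matrix is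
  a total function on pairs of indices; \<open>bholds\<close> inspects only indices below
  \<open>n\<close>, so no carrier condition arises.\<close>

primrec beval ::
  "(bool \<Rightarrow> bool \<Rightarrow> bool) \<Rightarrow> nat \<Rightarrow> (nat \<Rightarrow> nat \<Rightarrow> nat \<Rightarrow> bool) \<Rightarrow> trm \<Rightarrow> nat \<Rightarrow> nat \<Rightarrow> bool"
where
  "beval m n R (Var x) i j = R x i j"
| "beval m n R (Plus s t) i j = (beval m n R s i j \<or> beval m n R t i j)"
| "beval m n R (Times s t) i j = (\<exists>k<n. m (beval m n R s i k) (beval m n R t k j))"

definition bholds :: "(bool \<Rightarrow> bool \<Rightarrow> bool) \<Rightarrow> nat \<Rightarrow> trm \<Rightarrow> trm \<Rightarrow> bool" where
  "bholds m n u v \<longleftrightarrow> (\<forall>R. \<forall>i<n. \<forall>j<n. beval m n R u i j = beval m n R v i j)"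

definition bool_finitely_based :: "(bool \<Rightarrow> bool \<Rightarrow> bool) \<Rightarrow> nat \<Rightarrow> bool" where
  "bool_finitely_based m n \<longleftrightarrow>
     (\<exists>E. finite E \<and> (\<forall>(u, v)\<in>E. bholds m n u v) \<and> (\<forall>u v. bholds m n u v \<longrightarrow> follows E u v))"

lemma eval_mat_alg_carrier:
  assumes "range \<rho> \<subseteq> carrier_mat n n"
  shows "eval (mat_alg n :: 'a::ai_semiring mat alg) \<rho> t \<in> carrier_mat n n"
  using assms by (induction t) (auto simp: mat_alg_def)

lemma nsum_or:
  assumes "\<And>x y. T (x + y) = (T x \<or> T y)"
  shows "T (nsum f p) \<longleftrightarrow> (\<exists>k\<le>p. T (f k))"
  by (induction p) (auto simp: assms le_Suc_eq)

lemma eval_mat_alg_beval: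
  fixes T :: "'a::ai_semiring \<Rightarrow> bool"
  assumes T: "\<And>x y. T (x + y) = (T x \<or> T y)" "\<And>x y. T (x * y) = m (T x) (T y)"
    and "n \<ge> 1" "range \<rho> \<subseteq> carrier_mat n n" "i < n" "j < n"
  shows "T (eval (mat_alg n) \<rho> t $$ (i, j)) = beval m n (\<lambda>x i j. T (\<rho> x $$ (i, j))) t i j"
  using assms(5,6)
proof (induction t arbitrary: i j)
  case (Plus s t)
  have "eval (mat_alg n) \<rho> (Plus s t) $$ (i, j) =
    eval (mat_alg n) \<rho> s $$ (i, j) + eval (mat_alg n) \<rho> t $$ (i, j)"
    using Plus.prems carrier_matD[OF eval_mat_alg_carrier[OF assms(4), of t]]
    by (simp add: mat_alg_def)
  then show ?case
    by (simp add: T Plus.IH Plus.prems)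
next
  case (Times s t)
  have "T (eval (mat_alg n) \<rho> (Times s t) $$ (i, j)) \<longleftrightarrow>
    (\<exists>k\<le>n - 1. m (T (eval (mat_alg n) \<rho> s $$ (i, k))) (T (eval (mat_alg n) \<rho> t $$ (k, j))))"
    using Times.prems by (simp add: mat_alg_def nsum_or[of T] T)
  also have "\<dots> \<longleftrightarrow> (\<exists>k<n. m (T (eval (mat_alg n) \<rho> s $$ (i, k))) (T (eval (mat_alg n) \<rho> t $$ (k, j))))"
  proof -
    \<comment> \<open>\<open>nsum\<close> includes its last index \<open>n - 1\<close>; this
      describes \<open>k < n\<close> because \<open>n\<close> is positive.\<close>
    have "k \<le> n - 1 \<longleftrightarrow> k < n" for k
      using \<open>n \<ge> 1\<close> by arith
    then show ?thesis
      by simp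
  qed
  also have "\<dots> \<longleftrightarrow> beval m n (\<lambda>x i j. T (\<rho> x $$ (i, j))) (Times s t) i j"
    by (simp add: Times.IH Times.prems conj_commute cong: conj_cong)
  finally show ?case .
qed simp

text \<open>Surjectivity of \<open>T\<close> lets Boolean matrices be pulled back entrywise;
  injectivity lets equality of entries be tested after applying \<open>T\<close>.\<close>

lemma holds_iff_bholds:
  fixes T :: "'a::ai_semiring \<Rightarrow> bool"
  assumes T: "\<And>x y. T (x + y) = (T x \<or> T y)" "\<And>x y. T (x * y) = m (T x) (T y)" and "bij T"
    and "n \<ge> 1"
  shows "holds (mat_alg n :: 'a mat alg) u v \<longleftrightarrow> bholds m n u v"
proof
  assume h: "holds (mat_alg n :: 'a mat alg) u v"
  show "bholds m n u v"
    unfolding bholds_def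
  proof (intro allI impI)
    fix R :: "nat \<Rightarrow> nat \<Rightarrow> nat \<Rightarrow> bool" and i j
    assume ij: "i < n" "j < n"
    define \<rho> :: "nat \<Rightarrow> 'a mat" where "\<rho> x = mat n n (\<lambda>(i, j). inv_into UNIV T (R x i j))" for x
    have \<rho>: "range \<rho> \<subseteq> carrier_mat n n"
      by (auto simp: \<rho>_def)
    have b: "beval m n (\<lambda>x i j. T (\<rho> x $$ (i, j))) t i j = beval m n R t i j"
      if "i < n" "j < n" for t i j
      using that
      by (induction t arbitrary: i j) (auto simp: \<rho>_def bij_is_surj[OF \<open>bij T\<close>] f_inv_into_f)
    have "eval (mat_alg n) \<rho> u = eval (mat_alg n) \<rho> v"
      using h \<rho> by (simp add: holds_def mat_alg_def)
    moreover have "T (eval (mat_alg n) \<rho> t $$ (i, j)) = beval m n R t i j" for t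
      by (rule HOL.trans[OF eval_mat_alg_beval[of T m n \<rho> i j, OF T assms(4) \<rho> ij] b[OF ij]])
    ultimately show "beval m n R u i j = beval m n R v i j"
      by metis
  qed
next
  assume h: "bholds m n u v"
  show "holds (mat_alg n :: 'a mat alg) u v"
    unfolding holds_def
  proof (intro allI impI)
    fix \<rho> :: "nat \<Rightarrow> 'a mat"
    assume "range \<rho> \<subseteq> univ (mat_alg n)"
    then have \<rho>: "range \<rho> \<subseteq> carrier_mat n n"
      by (simp add: mat_alg_def)
    have e: "eval (mat_alg n) \<rho> u $$ (i, j) = eval (mat_alg n) \<rho> v $$ (i, j)"
      if ij: "i < n" "j < n" for i j
    proof (rule injD[OF bij_is_inj[OF \<open>bij T\<close>]])
      show "T (eval (mat_alg n) \<rho> u $$ (i, j)) = T (eval (mat_alg n) \<rho> v $$ (i, j))"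
        using eval_mat_alg_beval[of T m n \<rho> i j, OF T assms(4) \<rho> ij] h ij
        by (simp add: bholds_def)
    qed
    show "eval (mat_alg n) \<rho> u = eval (mat_alg n) \<rho> v"
    proof (rule eq_matI)
      fix i j
      assume "i < dim_row (eval (mat_alg n) \<rho> v)" "j < dim_col (eval (mat_alg n) \<rho> v)"
      then show "eval (mat_alg n) \<rho> u $$ (i, j) = eval (mat_alg n) \<rho> v $$ (i, j)"
        using e carrier_matD[OF eval_mat_alg_carrier[OF \<rho>, of v]] by metis
    qed (simp_all only: carrier_matD[OF eval_mat_alg_carrier[OF \<rho>]])
  qed
qed

lemma finitely_based_mat_alg_iff:
  fixes T :: "'a::ai_semiring \<Rightarrow> bool"
  assumes "\<And>x y. T (x + y) = (T x \<or> T y)" "\<And>x y. T (x * y) = m (T x) (T y)" "bij T" "n \<ge> 1"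
  shows "finitely_based (mat_alg n :: 'a mat alg) \<longleftrightarrow> bool_finitely_based m n"
proof -
  have "holds (mat_alg n :: 'a mat alg) = bholds m n"
    using holds_iff_bholds[of T m n, OF assms] by (intro ext)
  then show ?thesis
    by (simp only: finitely_based_def bool_finitely_based_def)
qed

lemma beval_subst: "beval m n R (subst \<sigma> t) i j = beval m n (\<lambda>x. beval m n R (\<sigma> x)) t i j"
  by (induction t arbitrary: i j) auto

section \<open>Terms as finite languages of nonempty words, the elements of the free
  ai-semiring\<close>

primrec lang :: "trm \<Rightarrow> nat list set" where
  "lang (Var x) = {[x]}"
| "lang (Plus s t) = lang s \<union> lang t"
| "lang (Times s t) = {v @ w | v w. v \<in> lang s \<and> w \<in> lang t}"

text \<open>Products are nested to the right. The signature has no unit, so the empty word denotes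
  no term.\<close>

fun word_term :: "nat list \<Rightarrow> trm" where
  "word_term [] = undefined"
| "word_term [x] = Var x"
| "word_term (x # w) = Times (Var x) (word_term w)"

lemma lang_word_term: "w \<noteq> [] \<Longrightarrow> lang (word_term w) = {w}"
  by (induction w rule: word_term.induct) auto

lemma lang_nonempty: "lang t \<noteq> {}"
  by (induction t) auto

lemma Nil_notin_lang: "[] \<notin> lang t"
  by (induction t) auto

text \<open>This bounds the word lengths in a finite set of identities, and hence the number of
  places where such an identity can cut a long word.\<close>

lemma lang_length_le_size: "w \<in> lang t \<Longrightarrow> length w \<le> Suc (size t)"
proof (induction t arbitrary: w)
  case (Times s t)
  then obtain v v' where "w = v @ v'" "v \<in> lang s" "v' \<in> lang t"
    by auto
  with Times.IH(1)[of v] Times.IH(2)[of v'] show ?case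
    by simp
next
  case (Plus s t)
  from Plus.prems Plus.IH(1)[of w] Plus.IH(2)[of w] show ?case
    by auto
qed simp

text \<open>Occurrences of letters are replaced independently: two occurrences of one variable may
  receive different words of its language.\<close>

lemma lang_subst:
  "w \<in> lang (subst \<sigma> t) \<longleftrightarrow>
    (\<exists>ys zs. ys \<in> lang t \<and> list_all2 (\<lambda>y z. z \<in> lang (\<sigma> y)) ys zs \<and> w = concat zs)"
proof (induction t arbitrary: w)
  case (Var x)
  then show ?case
    by (auto simp: list_all2_Cons1)
next
  case (Plus s t)
  then show ?case
    by auto
next
  case (Times s t)
  show ?case
  proof
    assume "w \<in> lang (subst \<sigma> (Times s t))"
    then obtain w1 w2 where w: "w = w1 @ w2" "w1 \<in> lang (subst \<sigma> s)" "w2 \<in> lang (subst \<sigma> t)"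
      by auto
    then obtain y1 z1 y2 z2 where
      "y1 \<in> lang s" "list_all2 (\<lambda>y z. z \<in> lang (\<sigma> y)) y1 z1" "w1 = concat z1"
      "y2 \<in> lang t" "list_all2 (\<lambda>y z. z \<in> lang (\<sigma> y)) y2 z2" "w2 = concat z2"
      using Times by metis
    then show "\<exists>ys zs. ys \<in> lang (Times s t) \<and> list_all2 (\<lambda>y z. z \<in> lang (\<sigma> y)) ys zs \<and> w = concat zs"
      using w by (intro exI[of _ "y1 @ y2"] exI[of _ "z1 @ z2"]) (auto intro: list_all2_appendI)
  next
    assume "\<exists>ys zs. ys \<in> lang (Times s t) \<and> list_all2 (\<lambda>y z. z \<in> lang (\<sigma> y)) ys zs \<and> w = concat zs"
    then obtain y1 y2 zs where
      y: "y1 \<in> lang s" "y2 \<in> lang t" "list_all2 (\<lambda>y z. z \<in> lang (\<sigma> y)) (y1 @ y2) zs" "w = concat zs"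
      by auto
    then show "w \<in> lang (subst \<sigma> (Times s t))"
      using Times by (fastforce simp: list_all2_append1)
  qed
qed

text \<open>A common scheme for all six products: \<open>S\<close> gives the value of a single word,
  and \<open>m\<close> distributes over joins. Only nonempty joins are asked for, since a constantly
  true \<open>m\<close> and disjunction do not preserve the empty one.\<close>

lemma beval_words:
  assumes single: "\<And>x i j. i < n \<Longrightarrow> j < n \<Longrightarrow> S [x] i j = R x i j"
    and append: "\<And>v w i j. v \<noteq> [] \<Longrightarrow> w \<noteq> [] \<Longrightarrow> i < n \<Longrightarrow> j < n \<Longrightarrow>
      S (v @ w) i j = (\<exists>k<n. m (S v i k) (S w k j))"
    and m: "\<And>(A :: nat list set) (B :: nat list set) P Q. A \<noteq> {} \<Longrightarrow> B \<noteq> {} \<Longrightarrow>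
      m (\<exists>v\<in>A. P v) (\<exists>w\<in>B. Q w) = (\<exists>v\<in>A. \<exists>w\<in>B. m (P v) (Q w))"
  shows "i < n \<Longrightarrow> j < n \<Longrightarrow> beval m n R t i j \<longleftrightarrow> (\<exists>w\<in>lang t. S w i j)"
proof (induction t arbitrary: i j)
  case (Times s t)
  have "beval m n R (Times s t) i j \<longleftrightarrow>
      (\<exists>k<n. m (\<exists>v\<in>lang s. S v i k) (\<exists>w\<in>lang t. S w k j))"
    by (simp add: Times.IH Times.prems cong: conj_cong)
  also have "\<dots> \<longleftrightarrow> (\<exists>k<n. \<exists>v\<in>lang s. \<exists>w\<in>lang t. m (S v i k) (S w k j))"
    by (simp only: m[OF lang_nonempty lang_nonempty])
  also have "\<dots> \<longleftrightarrow> (\<exists>v\<in>lang s. \<exists>w\<in>lang t. \<exists>k<n. m (S v i k) (S w k j))"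
    by blast
  also have "\<dots> \<longleftrightarrow> (\<exists>v\<in>lang s. \<exists>w\<in>lang t. S (v @ w) i j)"
    using append[OF _ _ Times.prems] Nil_notin_lang by (intro bex_cong HOL.refl) metis
  also have "\<dots> \<longleftrightarrow> (\<exists>w\<in>lang (Times s t). S w i j)"
    by auto
  finally show ?case .
qed (auto simp: single)

section \<open>Matrices over the distributive lattice\<close>

primrec path :: "nat \<Rightarrow> (nat \<Rightarrow> nat \<Rightarrow> nat \<Rightarrow> bool) \<Rightarrow> nat list \<Rightarrow> nat \<Rightarrow> nat \<Rightarrow> bool" where
  "path n R [] i j = (i = j)"
| "path n R (x # w) i j = (\<exists>k<n. R x i k \<and> path n R w k j)"

lemma path_append:
  "i < n \<Longrightarrow> path n R (v @ w) i j \<longleftrightarrow> (\<exists>k<n. path n R v i k \<and> path n R w k j)"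
  by (induction v arbitrary: i) (simp, simp, blast)

lemma path_ConsI:
  "R x i k \<Longrightarrow> k < n \<Longrightarrow> path n R w k j \<Longrightarrow> path n R (x # w) i j"
  by auto

lemma path_appendI:
  "path n R v i k \<Longrightarrow> k < n \<Longrightarrow> path n R w k j \<Longrightarrow> path n R (v @ w) i j"
  by (induction v arbitrary: i) auto

lemma beval_conj_path:
  "i < n \<Longrightarrow> j < n \<Longrightarrow> beval (\<and>) n R t i j \<longleftrightarrow> (\<exists>w\<in>lang t. path n R w i j)"
  by (rule beval_words) (auto simp: path_append)

text \<open>The syntactic congruence of \<open>L\<close>, with empty contexts allowed.\<close>

definition lang_cong :: "nat list set \<Rightarrow> trm \<Rightarrow> trm \<Rightarrow> bool" where
  "lang_cong L s t \<longleftrightarrow>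
     (\<forall>p q. (\<forall>w\<in>lang s. p @ w @ q \<in> L) \<longleftrightarrow> (\<forall>w\<in>lang t. p @ w @ q \<in> L))"

text \<open>The relation is an equivalence compatible with both operations: for a sum the condition
  splits into a conjunction, and in a product one factor joins the context while the other is
  exchanged. Thus what holds for the instances of \<open>E\<close> persists through every
  derivation.\<close>

lemma lang_cong_follows:
  assumes "follows E s t" and E: "\<And>u v \<sigma>. (u, v) \<in> E \<Longrightarrow> lang_cong L (subst \<sigma> u) (subst \<sigma> v)"
  shows "lang_cong L s t"
  using assms(1)
proof induction
  case (times u u' v v')
  show ?case
    unfolding lang_cong_def
  proof (intro allI)
    fix p q
    have "(\<forall>w\<in>lang (Times u v). p @ w @ q \<in> L) \<longleftrightarrow>
        (\<forall>x\<in>lang u. \<forall>y\<in>lang v. (p @ x) @ y @ q \<in> L)"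
      by fastforce
    also have "\<dots> \<longleftrightarrow> (\<forall>x\<in>lang u. \<forall>y\<in>lang v'. (p @ x) @ y @ q \<in> L)"
      using times.IH(2) unfolding lang_cong_def by blast
    also have "\<dots> \<longleftrightarrow> (\<forall>y\<in>lang v'. \<forall>x\<in>lang u. p @ x @ (y @ q) \<in> L)"
      by auto
    also have "\<dots> \<longleftrightarrow> (\<forall>y\<in>lang v'. \<forall>x\<in>lang u'. p @ x @ (y @ q) \<in> L)"
      using times.IH(1) unfolding lang_cong_def by blast
    also have "\<dots> \<longleftrightarrow> (\<forall>w\<in>lang (Times u' v'). p @ w @ q \<in> L)"
      by fastforce
    finally show "(\<forall>w\<in>lang (Times u v). p @ w @ q \<in> L) \<longleftrightarrow>
        (\<forall>w\<in>lang (Times u' v'). p @ w @ q \<in> L)" .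
  qed
qed (use E in \<open>auto simp: lang_cong_def ball_Un\<close>)

text \<open>A separated word is one that does not lie below the join of the words of
  \<open>L\<close>.\<close>

definition separated :: "nat \<Rightarrow> nat list set \<Rightarrow> nat list \<Rightarrow> bool" where
  "separated n L w \<longleftrightarrow>
     (\<exists>R. \<exists>i<n. \<exists>j<n. path n R w i j \<and> (\<forall>l\<in>L. \<not> path n R l i j))"

text \<open>In a graph that reads \<open>p @ s @ q\<close>, the part \<open>s\<close> can be
  replaced, between the same two vertices, by a word of the other side; the result belongs to
  \<open>L\<close>, so the graph does not separate.\<close>

lemma bholds_lang_subset:
  assumes "bholds (\<and>) n u v" and u: "\<forall>w\<in>lang (subst \<sigma> u). p @ w @ q \<in> L"
    and s: "s \<in> lang (subst \<sigma> v)"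
  shows "\<not> separated n L (p @ s @ q)"
proof
  assume "separated n L (p @ s @ q)"
  then obtain R i j where R: "i < n" "j < n" "path n R (p @ s @ q) i j" "\<forall>l\<in>L. \<not> path n R l i j"
    by (auto simp: separated_def)
  then obtain k l where kl: "k < n" "l < n" "path n R p i k" "path n R s k l" "path n R q l j"
    using path_append[OF R(1), of R p "s @ q" j] path_append[of _ n R s q j] by blast
  have "beval (\<and>) n R (subst \<sigma> v) k l"
    using kl s beval_conj_path[OF kl(1,2)] by blast
  then have "beval (\<and>) n R (subst \<sigma> u) k l"
    using assms(1) kl by (simp add: bholds_def beval_subst)
  then obtain w where w: "w \<in> lang (subst \<sigma> u)" "path n R w k l"
    using beval_conj_path[OF kl(1,2)] by blast
  have "path n R (w @ q) k j"
    using path_append[OF kl(1), of R w q j] kl w by blast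
  then have "path n R (p @ w @ q) i j"
    using path_append[OF R(1), of R p "w @ q" j] kl by blast
  then show False
    using R(4) u w(1) by blast
qed

section \<open>Walks with jumps on the positions of the long word\<close>

text \<open>
  The letter \<open>x\<close> is an edge from position \<open>x\<close> to position \<open>Suc x\<close> of \<open>[0..<m]\<close>, and consecutive
  letters of a walk may jump between related positions.
\<close>

primrec jump_walk :: "(nat \<Rightarrow> nat \<Rightarrow> bool) \<Rightarrow> nat list \<Rightarrow> nat \<Rightarrow> nat \<Rightarrow> bool" where
  "jump_walk P [] a b = P a b"
| "jump_walk P (x # w) a b = (P a x \<and> jump_walk P w (Suc x) b)"

text \<open>The jump that ends the first walk and the one that starts the second fuse by
  transitivity.\<close>

lemma jump_walk_append:
  assumes "transp P"
  shows "jump_walk P v a b \<Longrightarrow> jump_walk P w b c \<Longrightarrow> jump_walk P (v @ w) a c"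
proof (induction v arbitrary: a)
  case Nil
  then show ?case
    by (cases w) (auto intro: transpD[OF assms])
qed auto

lemma jump_walk_upt: "(\<And>x. P x x) \<Longrightarrow> a \<le> b \<Longrightarrow> jump_walk P [a..<b] a b"
proof (induction "b - a" arbitrary: a)
  case (Suc d)
  then have "[a..<b] = a # [Suc a..<b]"
    by (simp add: upt_conv_Cons)
  with Suc show ?case
    by simp
qed simp

text \<open>Reading \<open>y\<close> ends at \<open>Suc y\<close>, and the next jump leads from
  there to the start of \<open>x\<close>.\<close>

lemma jump_walk_adjacent: "jump_walk P (u @ y # x # v) a b \<Longrightarrow> P (Suc y) x"
  by (induction u arbitrary: a) auto

lemma sorted_distinct_upt: "sorted l \<Longrightarrow> distinct l \<Longrightarrow> set l = {..<m} \<Longrightarrow> l = [0..<m]"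
  using sorted_distinct_set_unique[of l "[0..<m]"] by (simp add: atLeast0LessThan)

lemma not_successively_adjacent:
  "\<not> successively P w \<Longrightarrow> \<exists>u y x v. w = u @ y # x # v \<and> \<not> P y x"
proof (induction w rule: induct_list012)
  case (3 a b w)
  show ?case
  proof (cases "P a b")
    case True
    with 3 obtain u y x v where "b # w = u @ y # x # v" "\<not> P y x"
      by auto
    then show ?thesis
      by (metis append_Cons)
  next
    case False
    then show ?thesis
      by (metis append_Nil)
  qed
qed auto

lemma upt_eq_concat_cuts:
  assumes "[a..<b] = concat zs" "a \<le> b" "i < length zs"
  shows "zs ! i = [a + length (concat (take i zs))..<a + length (concat (take (Suc i) zs))]"
proof -
  have z: "[a..<b] = concat (take i zs) @ zs ! i @ concat (drop (Suc i) zs)"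
    unfolding assms(1) using assms(3) by (metis concat.simps(2) concat_append id_take_nth_drop)
  have "zs ! i = take (length (zs ! i)) (drop (length (concat (take i zs))) [a..<b])"
    unfolding z by simp
  also have "\<dots> = [a + length (concat (take i zs))..<a + length (concat (take i zs)) + length (zs ! i)]"
  proof -
    have "length [a..<b] \<ge> length (concat (take i zs)) + length (zs ! i)"
      unfolding z by simp
    then show ?thesis
      using assms(2) by (simp add: take_upt drop_upt)
  qed
  finally show ?thesis
    using assms(3) by (simp add: take_Suc_conv_app_nth add.assoc)
qed

text \<open>
  Positions of equal colour among the cuts of \<open>[0..<m]\<close> are merged: the words that the resulting
  automaton with \<open>n\<close> states reads along blocks jump between cuts of equal colour only.
\<close>

lemma block_path_jump_walk:
  assumes "path n (\<lambda>y e e'. \<exists>i<length ys. y = ys ! i \<and> e = clr (c i) \<and> e' = clr (c (Suc i))) w e e'"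
    and "list_all2 (\<lambda>y z. z \<in> lang (\<sigma> y)) ys zs"
    and "\<And>i. i < length ys \<Longrightarrow> c i \<le> c (Suc i)"
    and "\<And>i. i < length ys \<Longrightarrow> zs ! i = [c i..<c (Suc i)]"
    and P: "P = (\<lambda>a b. a = b \<or> a \<in> c ` {..length ys} \<and> b \<in> c ` {..length ys} \<and> clr a = clr b)"
    and "a \<in> c ` {..length ys}" "clr a = e" "b \<in> c ` {..length ys}" "clr b = e'"
  shows "\<exists>zs'. list_all2 (\<lambda>y z. z \<in> lang (\<sigma> y)) w zs' \<and> jump_walk P (concat zs') a b"
  using assms(1) assms(6,7)
proof (induction w arbitrary: a e)
  case Nil
  then show ?case
    using assms(8,9) by (auto simp: P)
next
  case (Cons y w)
  then obtain i where i: "i < length ys" "y = ys ! i" "e = clr (c i)"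
    "path n (\<lambda>y e e'. \<exists>i<length ys. y = ys ! i \<and> e = clr (c i) \<and> e' = clr (c (Suc i))) w
      (clr (c (Suc i))) e'"
    by auto
  with Cons.IH[of _ "c (Suc i)"] obtain zs' where zs':
    "list_all2 (\<lambda>y z. z \<in> lang (\<sigma> y)) w zs'" "jump_walk P (concat zs') (c (Suc i)) b"
    by auto
  have tr: "transp P"
    by (auto simp: P transp_def)
  \<comment> \<open>The walk stands at a cut of the same colour as the left end of the next block,
    so it may jump there before reading the block.\<close>
  have "jump_walk P [] a (c i)"
    using Cons.prems(2,3) i by (auto simp: P)
  moreover have "jump_walk P (zs ! i) (c i) (c (Suc i))"
    using i(1) assms(3,4) by (simp add: jump_walk_upt P)
  ultimately have "jump_walk P (concat (zs ! i # zs')) a b"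
    using jump_walk_append[OF tr] zs'(2) by (metis append_Nil concat.simps(2))
  moreover have "zs ! i \<in> lang (\<sigma> y)"
    using assms(2) i by (auto simp: list_all2_conv_all_nth)
  ultimately show ?case
    using zs'(1) by (intro exI[of _ "zs ! i # zs'"]) simp
qed

text \<open>A descent from \<open>y\<close> to \<open>x\<close> is a backward jump from position
  \<open>Suc y\<close>, where the letter \<open>y\<close> ends, to \<open>x\<close>; this is the
  pair at which \<open>G\<close> is asked for. Ascents are unrestricted.\<close>

definition perms_with_jumps :: "(nat \<Rightarrow> nat \<Rightarrow> bool) \<Rightarrow> nat \<Rightarrow> nat list set" where
  "perms_with_jumps G m =
     {l. distinct l \<and> set l = {..<m} \<and> l \<noteq> [0..<m] \<and> successively (\<lambda>y x. x < y \<longrightarrow> G x (Suc y)) l}"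

lemma finite_perms_with_jumps: "finite (perms_with_jumps G m)"
proof (rule finite_subset)
  show "perms_with_jumps G m \<subseteq> {l. set l \<subseteq> {..<m} \<and> length l = m}"
    using distinct_card by (fastforce simp: perms_with_jumps_def)
  show "finite {l. set l \<subseteq> {..<m} \<and> length l = m}"
    by (rule finite_lists_length_eq) simp
qed

section \<open>Separating words from the language by graphs with two vertices\<close>

lemma separated_extra_letter:
  assumes "2 \<le> n" "y \<in> set w" "\<And>l. l \<in> L \<Longrightarrow> y \<notin> set l"
  shows "separated n L w"
proof -
  \<comment> \<open>Every letter loops at both vertices and only \<open>y\<close> leads from 0 to 1,
    so a walk from 0 to 1 detects an occurrence of \<open>y\<close>.\<close>
  define R where "R = (\<lambda>(z::nat) (i::nat) (j::nat). i < 2 \<and> (i = j \<or> z = y \<and> i = 0 \<and> j = (1::nat)))"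
  have R: "R z i j \<longleftrightarrow> i < 2 \<and> (i = j \<or> z = y \<and> i = 0 \<and> j = 1)" for z i j
    by (simp add: R_def)
  have loop: "i < 2 \<Longrightarrow> path n R v i i" for v i
    using assms(1) by (induction v) (auto simp: R intro!: exI[of _ i])
  have stay: "y \<notin> set v \<Longrightarrow> path n R v 0 j \<Longrightarrow> j = 0" for v j
    by (induction v) (auto simp: R)
  obtain u v where "w = u @ y # v"
    using split_list[OF assms(2)] by auto
  moreover have "path n R (y # v) 0 1"
    using assms(1) loop[of 1 v] by (auto simp: R intro!: exI[of _ "Suc 0"])
  ultimately have "path n R w 0 1"
    using path_appendI[of n R u 0 0 "y # v" 1] loop[of 0 u] assms(1) by simp
  then show ?thesis
    unfolding separated_def using assms(1,3) stay
    by (intro exI[of _ R] exI[of _ 0] exI[of _ 1] conjI) auto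
qed

lemma separated_missing_letter:
  assumes "2 \<le> n" "y \<notin> set w" "\<And>l. l \<in> L \<Longrightarrow> y \<in> set l"
  shows "separated n L w"
proof -
  \<comment> \<open>All letters but \<open>y\<close> loop at 0, so reading \<open>y\<close> is
    impossible.\<close>
  define R where "R = (\<lambda>(z::nat) (i::nat) (j::nat). i = 0 \<and> j = 0 \<and> z \<noteq> y)"
  have R: "R z i j \<longleftrightarrow> i = 0 \<and> j = 0 \<and> z \<noteq> y" for z i j
    by (simp add: R_def)
  have "path n R v 0 0 \<longleftrightarrow> y \<notin> set v" for v
    using assms(1) by (induction v) (auto simp: R)
  then show ?thesis
    unfolding separated_def using assms
    by (intro exI[of _ R] exI[of _ 0] conjI) auto
qed

lemma separated_repeated_letter:
  assumes "2 \<le> n" "\<not> distinct w" "\<And>l. l \<in> L \<Longrightarrow> distinct l \<and> set w \<subseteq> set l"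
  shows "separated n L w"
proof -
  obtain xs y ys zs where w: "w = xs @ [y] @ ys @ [y] @ zs"
    using not_distinct_decomp[OF assms(2)] by auto
  \<comment> \<open>Letters other than \<open>y\<close> stay put, and \<open>y\<close> has every
    edge except the loop at 0. A closed walk at 0 cannot read \<open>y\<close> exactly once, but can
    read it two or more times.\<close>
  obtain R :: "nat \<Rightarrow> nat \<Rightarrow> nat \<Rightarrow> bool"
    where R: "\<And>z i j. R z i j \<longleftrightarrow> i < 2 \<and> j < 2 \<and> (if z = y then i = 1 \<or> j = 1 else i = j)"
    by (rule that) (rule HOL.refl)
  have loop: "y \<notin> set v \<Longrightarrow> path n R v i j \<Longrightarrow> i < 2 \<Longrightarrow> j = i" for v i j
    by (induction v) (auto simp: R)
  have loop': "y \<notin> set v \<Longrightarrow> i < 2 \<Longrightarrow> path n R v i i" for v i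
    using assms(1) by (induction v) (auto simp: R intro!: exI[of _ i])
  have return: "path n R v 1 0" if "y \<in> set v" for v
    using that
  proof (induction v)
    case (Cons z v)
    show ?case
    proof (cases "y \<in> set v")
      case True
      then show ?thesis
        using assms(1) by (intro path_ConsI[OF _ _ Cons.IH[OF True]]) (auto simp: R)
    next
      case False
      then show ?thesis
        using Cons.prems False assms(1) by (intro path_ConsI[OF _ _ loop'[of v 0]]) (auto simp: R)
    qed
  qed simp
  have stay: "path n R v 1 1" for v
  proof (induction v)
    case (Cons z v)
    show ?case
      using assms(1) by (intro path_ConsI[OF _ _ Cons.IH]) (auto simp: R)
  qed simp
  have forth: "path n R v 0 1" if "y \<in> set v" for v
    using that
  proof (induction v)
    case (Cons z v)
    show ?case
    proof (cases "z = y")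
      case True
      then show ?thesis
        using assms(1) by (intro path_ConsI[OF _ _ stay[of v]]) (auto simp: R)
    next
      case False
      then show ?thesis
        using assms(1) Cons.prems by (intro path_ConsI[OF _ _ Cons.IH]) (auto simp: R)
    qed
  qed simp
  have "path n R ((xs @ [y]) @ ys @ [y] @ zs) 0 0"
    using forth[of "xs @ [y]"] return[of "ys @ [y] @ zs"] assms(1)
    by (intro path_appendI[of n R "xs @ [y]" 0 1]) auto
  moreover have "\<not> path n R l 0 0" if lL: "l \<in> L" for l
  proof
    assume p: "path n R l 0 0"
    obtain u v where l: "l = u @ y # v"
      using split_list[of y l] assms(3)[OF lL] w by auto
    then have uv: "y \<notin> set u" "y \<notin> set v"
      using assms(3)[OF lL] by auto
    from p l assms(1) obtain k k' where "path n R u 0 k" "R y k k'" "path n R v k' 0"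
      by (auto simp: path_append)
    then show False
      using loop[OF uv(1), of 0 k] loop[OF uv(2), of k' 0] by (auto simp: R)
  qed
  ultimately show ?thesis
    unfolding separated_def w using assms(1)
    by (intro exI[of _ R] exI[of _ 0] conjI) auto
qed

lemma separated_adjacent:
  assumes "2 \<le> n" "distinct (u @ y # x # v)"
    and L: "\<And>l. l \<in> L \<Longrightarrow> distinct l \<and> y \<in> set l"
    and nadj: "\<And>u' v'. u' @ y # x # v' \<notin> L"
  shows "separated n L (u @ y # x # v)"
proof -
  \<comment> \<open>Vertex 1 is entered only by \<open>y\<close> and left only by \<open>x\<close>,
    so in a closed walk at 0 each \<open>y\<close> is followed at once by \<open>x\<close>.\<close>
  define R where "R = (\<lambda>(z::nat) (i::nat) (j::nat).
    z = y \<and> i = 0 \<and> j = 1 \<or> z = x \<and> i = 1 \<and> j = 0 \<or> z \<noteq> x \<and> z \<noteq> y \<and> i = 0 \<and> j = 0)"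
  have R: "R z i j \<longleftrightarrow>
    z = y \<and> i = 0 \<and> j = 1 \<or> z = x \<and> i = 1 \<and> j = 0 \<or> z \<noteq> x \<and> z \<noteq> y \<and> i = 0 \<and> j = 0" for z i j
    by (simp add: R_def)
  have loop: "y \<notin> set w \<Longrightarrow> x \<notin> set w \<Longrightarrow> path n R w 0 0" for w
    using assms(1) by (induction w) (auto simp: R)
  have xy: "x \<noteq> y"
    using assms(2) by auto
  have "path n R (y # x # v) 0 0"
    using assms(1,2) loop[of v] xy by (auto simp: R intro!: exI[of _ "Suc 0"])
  then have "path n R (u @ y # x # v) 0 0"
    using assms(1,2) loop[of u] path_appendI[of n R u 0 0 "y # x # v" 0] by simp
  moreover have "\<not> path n R l 0 0" if lL: "l \<in> L" for l
  proof
    assume p: "path n R l 0 0"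
    obtain u' r where l: "l = u' @ y # r"
      using split_list[of y l] L[OF lL] by auto
    from p l assms(1) obtain k k' where "R y k k'" "path n R r k' 0"
      by (auto simp: path_append)
    then have "path n R r 1 0"
      using xy by (auto simp: R)
    moreover have "y \<notin> set r"
      using L[OF lL] l by auto
    ultimately obtain v' where "r = x # v'"
      by (cases r) (auto simp: R)
    then show False
      using nadj lL l by auto
  qed
  ultimately show ?thesis
    unfolding separated_def using assms(1)
    by (intro exI[of _ R] exI[of _ 0] conjI) auto
qed

text \<open>Consequently \<open>[0..<m]\<close> is the only word outside the language that can lie
  below its sum.\<close>

lemma separated_perms_with_jumps:
  assumes "2 \<le> n" "w \<notin> perms_with_jumps G m" "w \<noteq> [0..<m]"
  shows "separated n (perms_with_jumps G m) w"
proof -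
  let ?L = "perms_with_jumps G m"
  have L: "distinct l" "set l = {..<m}" if "l \<in> ?L" for l
    using that by (auto simp: perms_with_jumps_def)
  consider y where "y \<in> set w" "y \<ge> m" | y where "y < m" "y \<notin> set w"
    | "set w = {..<m}" "\<not> distinct w" | "set w = {..<m}" "distinct w"
    by (metis lessThan_iff not_le subsetI subset_antisym)
  then show ?thesis
  proof cases
    case 1
    then show ?thesis
      using separated_extra_letter[OF assms(1), of y w ?L] L by auto
  next
    case 2
    then show ?thesis
      using separated_missing_letter[OF assms(1), of y w ?L] L by auto
  next
    case 3
    then show ?thesis
      using separated_repeated_letter[OF assms(1), of w ?L] L by auto
  next
    case 4
    then have "\<not> successively (\<lambda>y x. x < y \<longrightarrow> G x (Suc y)) w"
      using assms(2,3) by (auto simp: perms_with_jumps_def)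
    then obtain u y x v where w: "w = u @ y # x # v" and xy: "x < y" "\<not> G x (Suc y)"
      using not_successively_adjacent by blast
    have "u' @ y # x # v' \<notin> ?L" for u' v'
      using xy by (auto simp: perms_with_jumps_def successively_append_iff)
    moreover have "y < m"
    proof -
      have "y \<in> set w"
        by (simp add: w)
      then show ?thesis
        unfolding 4(1) by simp
    qed
    ultimately show ?thesis
      unfolding w using 4 L by (intro separated_adjacent[OF assms(1)]) (simp_all add: w)
  qed
qed

section \<open>Colourings of the closed path of cliques\<close>

lemma mod_neq_close:
  fixes a b n :: nat
  assumes "a < b" "b < a + n"
  shows "a mod n \<noteq> b mod n"
proof
  assume "a mod n = b mod n"
  then have "n dvd b - a"
    using assms(1) mod_eq_dvd_iff_nat[of a b n] by simp
  then show False
    using assms dvd_imp_le[of n "b - a"] by simp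
qed

text \<open>
  A path of cliques closed up by one edge so that it is not \<open>n\<close>-colourable, but becomes
  \<open>n\<close>-colourable when a vertex is removed; for \<open>n = 2\<close> it is an odd cycle.
\<close>

definition clique_cycle :: "nat \<Rightarrow> nat \<Rightarrow> nat \<Rightarrow> nat \<Rightarrow> bool" where
  "clique_cycle n q u v \<longleftrightarrow> u < v \<and> (v < u + n \<or> u = 0 \<and> v = n * q)"

text \<open>Any \<open>n\<close> consecutive vertices form a clique and use all colours, so a proper
  colouring has period \<open>n\<close>. Then 0 and \<open>n * q\<close> share a colour although the
  closing edge joins them.\<close>

lemma clique_cycle_not_colourable:
  assumes "n \<ge> 1" "q \<ge> 1" and h: "\<And>v. v \<le> n * q \<Longrightarrow> h v < n"
  shows "\<exists>u v. v \<le> n * q \<and> clique_cycle n q u v \<and> h u = h v"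
proof (rule ccontr)
  assume neg: "\<not> ?thesis"
  have step: "h (i + n) = h i" if i: "i + n \<le> n * q" for i
  proof -
    have "inj_on h {i..<i + n}"
    proof (rule linorder_inj_onI')
      fix u v assume uv: "u \<in> {i..<i + n}" "v \<in> {i..<i + n}" "u < v"
      then have "clique_cycle n q u v" "v \<le> n * q"
        using i by (auto simp: clique_cycle_def)
      then show "h u \<noteq> h v"
        using neg by blast
    qed
    then have "card (h ` {i..<i + n}) = n"
      by (simp add: card_image)
    moreover have "h ` {i..<i + n} \<subseteq> {..<n}"
      using i h by auto
    ultimately have "h ` {i..<i + n} = {..<n}"
      by (intro card_subset_eq) auto
    then obtain k where k: "k \<in> {i..<i + n}" "h (i + n) = h k"
      using h[OF i] by (metis imageE lessThan_iff)
    have "k = i"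
    proof (rule ccontr)
      assume "k \<noteq> i"
      then have "clique_cycle n q k (i + n)"
        using k(1) by (auto simp: clique_cycle_def)
      then show False
        using neg k(2) i by (metis (no_types))
    qed
    then show ?thesis
      using k by simp
  qed
  have "j \<le> q \<Longrightarrow> h (n * j) = h 0" for j
  proof (induction j)
    case (Suc j)
    have "n * j + n \<le> n * q"
      using mult_le_mono2[OF Suc.prems, of n] by simp
    then show ?case
      using Suc step[of "n * j"] by (simp add: add.commute)
  qed simp
  moreover have "clique_cycle n q 0 (n * q)"
    using assms(1,2) by (simp add: clique_cycle_def)
  ultimately show False
    using neg by (metis order_refl)
qed

text \<open>After removal of \<open>d\<close> the other vertices are renumbered without a gap and
  coloured modulo \<open>n\<close>. Close vertices stay close, and the ends of the closing edge
  become 0 and \<open>n * q - 1\<close>, with colours 0 and \<open>n - 1\<close>.\<close>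

lemma clique_cycle_colourable:
  assumes "n \<ge> 2" "q \<ge> 1" "clique_cycle n q u v" "u \<noteq> d" "v \<noteq> d" "d \<le> n * q"
  shows "(if u < d then u else u - 1) mod n \<noteq> (if v < d then v else v - 1) mod n"
proof (cases "v < u + n")
  case True
  then show ?thesis
    using assms(3-5) by (intro mod_neq_close) (auto simp: clique_cycle_def)
next
  case False
  then have uv: "u = 0" "v = n * q"
    using assms(3) by (auto simp: clique_cycle_def)
  obtain k where k: "q = Suc k"
    using assms(2) by (cases q) auto
  have "n * q - 1 = n - 1 + n * k"
    using assms(1) by (simp add: k)
  then have "(n * q - 1) mod n = (n - 1) mod n"
    by (simp only: mod_mult_self2)
  then have "(n * q - 1) mod n = n - 1"
    using assms(1) by simp
  then show ?thesis
    using uv assms by simp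
qed

text \<open>By separation, the only word that could leave the language is \<open>[0..<m]\<close>. An
  instance of a short identity cuts it at too few positions to meet every vertex of the graph; a
  proper colouring of the vertices met then gives a matrix assignment refuting the identity.\<close>

lemma lang_perms_with_jumps_step:
  assumes "2 \<le> n" "1 \<le> q" "bholds (\<and>) n u v" "\<And>w. w \<in> lang v \<Longrightarrow> length w < n * q"
    and G: "G = (\<lambda>a c. clique_cycle n q (a div Suc n) (c div Suc n))"
    and u: "\<forall>w\<in>lang (subst \<sigma> u). p @ w @ z \<in> perms_with_jumps G m"
    and s: "s \<in> lang (subst \<sigma> v)"
  shows "p @ s @ z \<in> perms_with_jumps G m"
proof (rule ccontr)
  assume "p @ s @ z \<notin> perms_with_jumps G m"
  moreover have "\<not> separated n (perms_with_jumps G m) (p @ s @ z)"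
    using bholds_lang_subset[OF assms(3) u s] .
  ultimately have W: "p @ s @ z = [0..<m]"
    using separated_perms_with_jumps[OF assms(1)] by blast
  have len: "length p + length s + length z = m"
    using arg_cong[OF W, of length] by simp
  have p: "p = [0..<length p]"
    using arg_cong[OF W, of "take (length p)"] len by (simp add: take_upt)
  have sz: "s @ z = [length p..<m]"
    using arg_cong[OF W, of "drop (length p)"] by (simp add: drop_upt)
  have s_upt: "s = [length p..<length p + length s]"
    using arg_cong[OF sz, of "take (length s)"] len by (simp add: take_upt)
  have z: "z = [length p + length s..<m]"
    using arg_cong[OF sz, of "drop (length s)"] by (simp add: drop_upt)
  obtain ys zs where ys: "ys \<in> lang v" "list_all2 (\<lambda>y z. z \<in> lang (\<sigma> y)) ys zs" "s = concat zs"
    using s by (auto simp: lang_subst)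
  have l: "length zs = length ys"
    using ys(2) by (simp add: list_all2_lengthD)
  define c where "c i = length p + length (concat (take i zs))" for i
  have c0: "c 0 = length p" and cl: "c (length ys) = length p + length s"
    using ys(3) l by (simp_all add: c_def)
  have blocks: "zs ! i = [c i..<c (Suc i)]" if "i < length ys" for i
    using upt_eq_concat_cuts[of "length p" "length p + length s" zs i] s_upt ys(3) l that
    by (simp add: c_def)
  have mono: "c i \<le> c (Suc i)" if "i < length ys" for i
    using that l by (simp add: c_def take_Suc_conv_app_nth)
  define C where "C = c ` {..length ys}"
  \<comment> \<open>Position \<open>a\<close> lies over the vertex \<open>a div Suc n\<close>. There
    are at most \<open>n * q\<close> cuts but \<open>n * q + 1\<close> vertices, so some vertex
    \<open>d\<close> has no cut over it.\<close>
  have "card ((\<lambda>a. a div Suc n) ` C) \<le> card C"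
    unfolding C_def by (intro card_image_le) simp
  also have "\<dots> \<le> card {..length ys}"
    unfolding C_def by (intro card_image_le) simp
  also have "\<dots> < card {..n * q}"
    using assms(4)[OF ys(1)] by simp
  finally have "\<not> {..n * q} \<subseteq> (\<lambda>a. a div Suc n) ` C"
    using card_mono[of "(\<lambda>a. a div Suc n) ` C" "{..n * q}"] by (auto simp: C_def)
  then obtain d where d: "d \<le> n * q" "d \<notin> (\<lambda>a. a div Suc n) ` C"
    by auto
  define clr where
    "clr a = (if a div Suc n < d then a div Suc n else a div Suc n - 1) mod n" for a
  have clr: "clr a < n" for a
    using assms(1) by (simp add: clr_def)
  \<comment> \<open>The vertices of this automaton are the colours; each letter of \<open>ys\<close>
    joins the colours at the two ends of its block.\<close>
  define R where "R = (\<lambda>y e e'. \<exists>i<length ys. y = ys ! i \<and> e = clr (c i) \<and> e' = clr (c (Suc i)))"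
  have "path n R (drop i ys) (clr (c i)) (clr (c (length ys)))" if "i \<le> length ys" for i
    using that
  proof (induction rule: inc_induct)
    case (step i)
    then have "drop i ys = ys ! i # drop (Suc i) ys"
      by (simp add: Cons_nth_drop_Suc)
    then show ?case
      using step clr by (auto simp: R_def)
  qed simp
  from this[of 0] have "path n R ys (clr (c 0)) (clr (c (length ys)))"
    by simp
  then have "beval (\<and>) n R v (clr (c 0)) (clr (c (length ys)))"
    using ys(1) clr beval_conj_path by blast
  then have "beval (\<and>) n R u (clr (c 0)) (clr (c (length ys)))"
    using assms(3) clr by (simp add: bholds_def)
  then obtain w where w: "w \<in> lang u" "path n R w (clr (c 0)) (clr (c (length ys)))"
    using clr beval_conj_path by blast
  define P where "P = (\<lambda>a b. a = b \<or> a \<in> C \<and> b \<in> C \<and> clr a = clr b)"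
  obtain zs' where zs': "list_all2 (\<lambda>y z. z \<in> lang (\<sigma> y)) w zs'"
    "jump_walk P (concat zs') (c 0) (c (length ys))"
    using block_path_jump_walk[OF w(2)[unfolded R_def] ys(2) mono blocks
        P_def[unfolded C_def], of "c 0" "c (length ys)"] by auto
  have zs'_walk: "jump_walk P (concat zs') (length p) (length p + length s)"
    using zs'(2) by (simp only: c0 cl)
  let ?l = "p @ concat zs' @ z"
  have L: "?l \<in> perms_with_jumps G m"
    using u w(1) zs'(1) lang_subst by blast
  have P: "transp P" "\<And>x. P x x"
    by (auto simp: P_def transp_def)
  have "jump_walk P p 0 (length p)"
    by (subst p) (simp add: jump_walk_upt P(2))
  moreover have "jump_walk P z (length p + length s) m"
    by (subst z) (simp add: jump_walk_upt P(2) len[symmetric])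
  ultimately have walk: "jump_walk P ?l 0 m"
    using jump_walk_append[OF P(1)] zs'_walk by blast
  \<comment> \<open>A sorted word with these letters would be \<open>[0..<m]\<close>, which the
    language excludes; so there is a descent.\<close>
  have "\<not> successively (\<le>) ?l"
  proof
    assume "successively (\<le>) ?l"
    then have "sorted ?l"
      using successively_iff_sorted_wrt_strong[of ?l "(\<le>)"] by fastforce
    then show False
      using sorted_distinct_upt[of ?l m] L by (simp add: perms_with_jumps_def)
  qed
  then obtain u' y x v' where l: "?l = u' @ y # x # v'" "\<not> y \<le> x"
    using not_successively_adjacent by blast
  \<comment> \<open>Membership in the language makes the jump at the descent an edge of
    \<open>G\<close>, whereas the walk jumps only between cuts of equal colour.\<close>
  have "G x (Suc y)"
    using L l(2) unfolding perms_with_jumps_def l(1) by (simp add: successively_append_iff)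
  have "P (Suc y) x"
    using jump_walk_adjacent walk unfolding l(1) .
  then have Pyx: "Suc y \<in> C" "x \<in> C" "clr (Suc y) = clr x"
    using l(2) by (auto simp: P_def)
  then have "x div Suc n \<noteq> d" "Suc y div Suc n \<noteq> d"
    using d(2) by auto
  then have "clr x \<noteq> clr (Suc y)"
    unfolding clr_def using \<open>G x (Suc y)\<close> d(1) assms(1,2)
    by (intro clique_cycle_colourable) (simp_all add: G)
  then show False
    using Pyx by simp
qed

section \<open>Validity of the long identity and failure of every finite basis\<close>

lemma path_states:
  assumes "path n R w i j" "i < n"
  shows "\<exists>f. f 0 = i \<and> f (length w) = j \<and> (\<forall>k\<le>length w. f k < n) \<and>
    (\<forall>k<length w. R (w ! k) (f k) (f (Suc k)))"
  using assms
proof (induction w arbitrary: i)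
  case (Cons x w)
  then obtain k where k: "k < n" "R x i k" "path n R w k j"
    by auto
  from Cons.IH[OF k(3,1)] obtain f where f: "f 0 = k" "f (length w) = j"
    "\<forall>k\<le>length w. f k < n" "\<forall>k<length w. R (w ! k) (f k) (f (Suc k))"
    by blast
  show ?case
    using f k Cons.prems
    by (intro exI[of _ "\<lambda>a. case a of 0 \<Rightarrow> i | Suc a \<Rightarrow> f a"]) (auto split: nat.split simp: nth_Cons)
qed auto

lemma path_upt:
  assumes "a \<le> b" "\<And>k. k \<le> b \<Longrightarrow> f k < n" "\<And>k. k < b \<Longrightarrow> R k (f k) (f (Suc k))"
  shows "path n R [a..<b] (f a) (f b)"
  using assms(1)
proof (induction rule: inc_induct)
  case (step k)
  then show ?case
    using assms(2)[of "Suc k"] assms(3)[of k] by (auto simp: upt_conv_Cons)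
qed simp

text \<open>Each vertex carries \<open>Suc n\<close> positions, so two of them,
  \<open>A v < B v\<close>, get the same colour. Colouring \<open>v\<close> like \<open>A v\<close>
  cannot be proper; a monochromatic edge from \<open>u\<close> to \<open>v\<close> yields
  \<open>A u\<close>, \<open>B u\<close>, \<open>A v\<close>.\<close>

lemma monochromatic_triple:
  assumes "n \<ge> 1" "q \<ge> 1" and f: "\<And>k. k < Suc (n * q) * Suc n \<Longrightarrow> f k < n"
  obtains a b c where "a < b" "b < c" "c < Suc (n * q) * Suc n" "f a = f b" "f b = f c"
    "clique_cycle n q (a div Suc n) (c div Suc n)"
proof -
  have "\<exists>a b. a < b \<and> a div Suc n = v \<and> b div Suc n = v \<and> f a = f b \<and> b < Suc (n * q) * Suc n"
    if v: "v \<le> n * q" for v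
  proof -
    let ?I = "{v * Suc n..<v * Suc n + Suc n}"
    have "Suc v * Suc n \<le> Suc (n * q) * Suc n"
      using v by (intro mult_le_mono1) simp
    then have I: "?I \<subseteq> {..<Suc (n * q) * Suc n}"
      by auto
    then have "f ` ?I \<subseteq> {..<n}"
      using f by auto
    then have "card (f ` ?I) \<le> n"
      using card_mono[of "{..<n}" "f ` ?I"] by simp
    then have "\<not> inj_on f ?I"
      using card_image[of f ?I] by auto
    then obtain a b where ab: "a \<in> ?I" "b \<in> ?I" "a < b" "f a = f b"
      using linorder_inj_onI'[of ?I f] by blast
    have "k div Suc n = v" if "k \<in> ?I" for k
      using that by (intro div_nat_eqI) (simp_all add: mult.commute)
    then show ?thesis
      using ab I by blast
  qed
  then obtain A B where AB: "\<And>v. v \<le> n * q \<Longrightarrow> A v < B v \<and> A v div Suc n = v \<and> B v div Suc n = v \<and>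
      f (A v) = f (B v) \<and> B v < Suc (n * q) * Suc n"
    by metis
  then obtain u v where uv: "v \<le> n * q" "clique_cycle n q u v" "f (A u) = f (A v)"
    using clique_cycle_not_colourable[of n q "\<lambda>v. f (A v)"] assms(1,2) f by (metis less_trans)
  then have u: "u < v"
    by (simp add: clique_cycle_def)
  have "B u < A v"
  proof (rule ccontr)
    assume "\<not> B u < A v"
    then have "A v div Suc n \<le> B u div Suc n"
      by (intro div_le_mono) simp
    then show False
      using AB[of u] AB[of v] uv(1) u by simp
  qed
  then show ?thesis
    using AB[of u] AB[of v] uv u by (intro that[of "A u" "B u" "A v"]) auto
qed

text \<open>The only descent is from \<open>c - 1\<close> to \<open>a\<close>, which asks for
  \<open>G a c\<close>; position \<open>a\<close> now holds \<open>b\<close>, so the word has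
  changed.\<close>

lemma segment_swap_in_perms_with_jumps:
  assumes "a < b" "b < c" "c < m" "G a c"
  shows "[0..<a] @ [b..<c] @ [a..<b] @ [c..<m] \<in> perms_with_jumps G m"
proof -
  have "successively (\<lambda>y x. x < y \<longrightarrow> G x (Suc y)) [i..<j]" for i j
    by (induction j) (auto simp: successively_append_iff last_upt le_eq_less_or_eq)
  moreover have "[0..<a] @ [b..<c] @ [a..<b] @ [c..<m] \<noteq> [0..<m]"
  proof
    assume "[0..<a] @ [b..<c] @ [a..<b] @ [c..<m] = [0..<m]"
    then have "([0..<a] @ [b..<c] @ [a..<b] @ [c..<m]) ! a = [0..<m] ! a"
      by simp
    then show False
      using assms by (simp add: nth_append)
  qed
  ultimately show ?thesis
    using assms
    by (cases "a = 0") (auto simp: perms_with_jumps_def successively_append_iff last_upt)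
qed

lemma finite_language_term:
  assumes "finite L" "L \<noteq> {}" "[] \<notin> L"
  shows "\<exists>t. lang t = L"
  using assms
proof (induction rule: finite_ne_induct)
  case (singleton w)
  then show ?case
    using lang_word_term[of w] by auto
next
  case (insert w L)
  then obtain t where "lang t = L"
    by auto
  then have "lang (Plus (word_term w) t) = insert w L"
    using insert.prems lang_word_term[of w] by auto
  then show ?case
    by blast
qed

lemma conj_not_finitely_based:
  assumes "n \<ge> 2"
  shows "\<not> bool_finitely_based (\<and>) n"
proof
  assume "bool_finitely_based (\<and>) n"
  then obtain E where E: "finite E" "\<And>u v. (u, v) \<in> E \<Longrightarrow> bholds (\<and>) n u v"
    "\<And>u v. bholds (\<and>) n u v \<Longrightarrow> follows E u v"
    by (auto simp: bool_finitely_based_def)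
  have "finite ((\<lambda>(u, v). size u + size v) ` E)"
    using E(1) by simp
  then obtain K where K: "\<And>u v. (u, v) \<in> E \<Longrightarrow> size u + size v \<le> K"
    unfolding finite_nat_set_iff_bounded_le by fastforce
  \<comment> \<open>Words of identities in \<open>E\<close> have length at most
    \<open>Suc K\<close>, hence less than \<open>n * q\<close>.\<close>
  define q where "q = Suc (Suc K)"
  have q: "1 \<le> q" "Suc K < n * q"
    using assms mult_le_mono1[of 1 n q] by (simp_all add: q_def)
  define m where "m = Suc (n * q) * Suc n"
  define G where "G = (\<lambda>a c. clique_cycle n q (a div Suc n) (c div Suc n))"
  let ?L = "perms_with_jumps G m"
  have readable: "\<exists>l\<in>?L. path n R l i j" if R: "path n R [0..<m] i j" and i: "i < n" for R i j
  proof -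
    obtain f where f: "f 0 = i" "f m = j" "\<And>k. k \<le> m \<Longrightarrow> f k < n"
      "\<And>k. k < m \<Longrightarrow> R k (f k) (f (Suc k))"
      using path_states[OF R i] by auto
    obtain a b c where abc: "a < b" "b < c" "c < m" "f a = f b" "f b = f c"
      "clique_cycle n q (a div Suc n) (c div Suc n)"
      using monochromatic_triple[of n q f] assms q(1) f(3) unfolding m_def[symmetric] by auto
    have seg: "path n R [x..<y] (f x) (f y)" if "x \<le> y" "y \<le> m" for x y
      using that f(3,4) by (intro path_upt) auto
    have fn: "f a < n" "f b < n" "f c < n"
      using abc f(3) by auto
    \<comment> \<open>As \<open>f a = f b = f c\<close>, both inner segments are closed walks at one
      vertex and may be exchanged.\<close>
    have "path n R ([0..<a] @ [b..<c] @ [a..<b] @ [c..<m]) (f 0) (f m)"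
      using seg[of 0 a] seg[of b c] seg[of a b] seg[of c m] abc fn
      by (intro path_appendI[OF _ fn(1)]) auto
    then show ?thesis
      using segment_swap_in_perms_with_jumps[of a b c m G] abc f(1,2) by (auto simp: G_def)
  qed
  \<comment> \<open>The complete graph reads \<open>[0..<m]\<close>, so \<open>readable\<close>
    supplies a word of the language.\<close>
  have "path n (\<lambda>_ _ _. True) w 0 0" for w
    using assms by (induction w) (auto intro: exI[of _ 0])
  then have "?L \<noteq> {}"
    using readable[of "\<lambda>_ _ _. True" 0 0] assms by auto
  moreover have "[] \<notin> ?L"
    by (auto simp: perms_with_jumps_def m_def)
  ultimately obtain u where u: "lang u = ?L"
    using finite_language_term[OF finite_perms_with_jumps] by blast
  define v where "v = Plus u (word_term [0..<m])"
  have "lang (word_term [0..<m]) = {[0..<m]}"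
    by (intro lang_word_term) (simp add: m_def)
  then have v: "lang v = insert [0..<m] ?L"
    using u by (auto simp: v_def)
  have "bholds (\<and>) n u v"
    unfolding bholds_def using readable by (auto simp: beval_conj_path u v)
  then have "follows E u v"
    by (rule E(3))
  moreover have "lang_cong ?L (subst \<sigma> s) (subst \<sigma> t)" if st: "(s, t) \<in> E" for s t \<sigma>
  proof -
    have len: "length w < n * q" if "w \<in> lang s \<union> lang t" for w
      using that lang_length_le_size[of w s] lang_length_le_size[of w t] K[OF st] q(2) by auto
    have h: "bholds (\<and>) n s t" "bholds (\<and>) n t s"
      using E(2)[OF st] by (simp_all add: bholds_def)
    show ?thesis
      unfolding lang_cong_def
      using lang_perms_with_jumps_step[OF assms q(1) h(1) len G_def]
        lang_perms_with_jumps_step[OF assms q(1) h(2) len G_def] by blast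
  qed
  ultimately have "lang_cong ?L u v"
    by (rule lang_cong_follows)
  \<comment> \<open>Empty contexts suffice: all words of \<open>u\<close> lie in the language, so
    \<open>[0..<m]\<close> would as well.\<close>
  then have "\<forall>w\<in>lang v. w \<in> ?L"
    unfolding lang_cong_def u by (metis append.right_neutral append_Nil)
  then show False
    by (simp add: v perms_with_jumps_def)
qed

section \<open>Finite bases for the other products\<close>

definition ai_semiring_identities :: "identity set" where
  "ai_semiring_identities =
     {(Plus (Plus (Var 0) (Var 1)) (Var 2), Plus (Var 0) (Plus (Var 1) (Var 2))),
      (Plus (Var 0) (Var 1), Plus (Var 1) (Var 0)),
      (Plus (Var 0) (Var 0), Var 0),
      (Times (Times (Var 0) (Var 1)) (Var 2), Times (Var 0) (Times (Var 1) (Var 2))),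
      (Times (Var 0) (Plus (Var 1) (Var 2)), Plus (Times (Var 0) (Var 1)) (Times (Var 0) (Var 2))),
      (Times (Plus (Var 0) (Var 1)) (Var 2), Plus (Times (Var 0) (Var 2)) (Times (Var 1) (Var 2)))}"

definition below :: "identity set \<Rightarrow> trm \<Rightarrow> trm \<Rightarrow> bool" where
  "below E s t \<longleftrightarrow> follows E (Plus s t) t"

text \<open>\<open>None\<close> stands in for a unit: optional factors express contexts that may be
  empty on either side.\<close>

primrec opt_times_left :: "trm option \<Rightarrow> trm \<Rightarrow> trm" where
  "opt_times_left None t = t"
| "opt_times_left (Some p) t = Times p t"

primrec opt_times_right :: "trm option \<Rightarrow> trm \<Rightarrow> trm" where
  "opt_times_right None t = t"
| "opt_times_right (Some q) t = Times t q"

locale ai_semiring_theory =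
  fixes E :: "identity set"
  assumes axioms: "ai_semiring_identities \<subseteq> E"
begin

text \<open>A list of terms serves as substitution: variable \<open>k\<close> receives entry
  \<open>k\<close>.\<close>

lemma ax_nth: "(u, v) \<in> E \<Longrightarrow> follows E (subst ((!) ts) u) (subst ((!) ts) v)"
  by (rule follows.ax)

lemma below_instance: "(Plus u v, v) \<in> E \<Longrightarrow> below E (subst ((!) ts) u) (subst ((!) ts) v)"
  using ax_nth[of "Plus u v" v ts] by (simp add: below_def)

lemma plus_assoc: "follows E (Plus (Plus s t) r) (Plus s (Plus t r))"
  using ax_nth[of "Plus (Plus (Var 0) (Var 1)) (Var 2)" _ "[s, t, r]"] axioms
  by (force simp: ai_semiring_identities_def)

lemma plus_comm: "follows E (Plus s t) (Plus t s)"
  using ax_nth[of "Plus (Var 0) (Var 1)" "Plus (Var 1) (Var 0)" "[s, t]"] axioms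
  by (force simp: ai_semiring_identities_def)

lemma plus_idem: "follows E (Plus s s) s"
  using ax_nth[of "Plus (Var 0) (Var 0)" "Var 0" "[s]"] axioms
  by (force simp: ai_semiring_identities_def)

lemma times_assoc: "follows E (Times (Times s t) r) (Times s (Times t r))"
  using ax_nth[of "Times (Times (Var 0) (Var 1)) (Var 2)" _ "[s, t, r]"] axioms
  by (force simp: ai_semiring_identities_def)

lemma distrib_left: "follows E (Times s (Plus t r)) (Plus (Times s t) (Times s r))"
  using ax_nth[of "Times (Var 0) (Plus (Var 1) (Var 2))" _ "[s, t, r]"] axioms
  by (force simp: ai_semiring_identities_def)

lemma distrib_right: "follows E (Times (Plus s t) r) (Plus (Times s r) (Times t r))"
  using ax_nth[of "Times (Plus (Var 0) (Var 1)) (Var 2)" _ "[s, t, r]"] axioms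
  by (force simp: ai_semiring_identities_def)

lemmas [trans] = follows.trans

lemma follows_below: "follows E s t \<Longrightarrow> below E s t"
  unfolding below_def by (meson follows.plus follows.refl follows.trans plus_idem)

lemma below_refl: "below E s s"
  by (simp add: follows_below follows.refl)

lemma below_trans [trans]:
  assumes "below E s t" "below E t r"
  shows "below E s r"
proof -
  have "follows E (Plus s r) (Plus s (Plus t r))"
    using assms(2) unfolding below_def by (meson follows.plus follows.refl follows.sym)
  also have "follows E \<dots> (Plus (Plus s t) r)"
    by (rule follows.sym[OF plus_assoc])
  also have "follows E \<dots> (Plus t r)"
    using assms(1) unfolding below_def by (meson follows.plus follows.refl)
  also have "follows E \<dots> r"
    using assms(2) unfolding below_def .
  finally show ?thesis
    unfolding below_def .
qed

lemma follows_below_trans: "follows E s t \<Longrightarrow> below E t r \<Longrightarrow> below E s r"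
  by (rule below_trans[OF follows_below])

lemma below_follows_trans: "below E s t \<Longrightarrow> follows E t r \<Longrightarrow> below E s r"
  by (rule below_trans[OF _ follows_below])

lemma below_antisym: "below E s t \<Longrightarrow> below E t s \<Longrightarrow> follows E s t"
  unfolding below_def by (meson follows.sym follows.trans plus_comm)

lemma below_plus1: "below E s (Plus s t)"
  unfolding below_def
  by (meson follows.plus follows.refl follows.sym follows.trans plus_assoc plus_idem)

lemma below_plus2: "below E t (Plus s t)"
  using below_trans[OF below_plus1 follows_below[OF plus_comm]] .

lemma plus_below:
  assumes "below E s r" "below E t r"
  shows "below E (Plus s t) r"
  using assms unfolding below_def
  by (meson follows.plus follows.refl follows.trans plus_assoc)

lemma times_below_left: "below E s t \<Longrightarrow> below E (Times r s) (Times r t)"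
  unfolding below_def by (meson distrib_left follows.refl follows.sym follows.times follows.trans)

lemma times_below_right: "below E s t \<Longrightarrow> below E (Times s r) (Times t r)"
  unfolding below_def by (meson distrib_right follows.refl follows.sym follows.times follows.trans)

lemma times_below: "below E s s' \<Longrightarrow> below E t t' \<Longrightarrow> below E (Times s t) (Times s' t')"
  by (meson below_trans times_below_left times_below_right)

lemma word_term_append:
  "v \<noteq> [] \<Longrightarrow> w \<noteq> [] \<Longrightarrow> follows E (word_term (v @ w)) (Times (word_term v) (word_term w))"
proof (induction v rule: word_term.induct)
  case (2 x)
  then show ?case
    by (cases w) (auto intro: follows.refl)
next
  case (3 x y v)
  then show ?case
    using follows.trans[OF follows.times[OF follows.refl] follows.sym[OF times_assoc]] by simp
qed simp

lemma word_below: "w \<in> lang t \<Longrightarrow> below E (word_term w) t"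
proof (induction t arbitrary: w)
  case (Plus s t)
  then show ?case
    using below_trans[OF _ below_plus1] below_trans[OF _ below_plus2] by fastforce
next
  case (Times s t)
  then obtain u v where w: "w = u @ v" "u \<in> lang s" "v \<in> lang t"
    by auto
  then have "u \<noteq> []" "v \<noteq> []"
    using Nil_notin_lang by auto
  then have "below E (word_term w) (Times (word_term u) (word_term v))"
    using w(1) by (simp add: follows_below word_term_append)
  also have "below E \<dots> (Times s t)"
    using Times.IH w by (simp add: times_below)
  finally show ?case .
qed (simp add: below_refl)

lemma opt_times_follows:
  "follows E s t \<Longrightarrow>
    follows E (opt_times_left p (opt_times_right q s)) (opt_times_left p (opt_times_right q t))"
  by (cases p; cases q) (auto intro: follows.times follows.refl)

text \<open>The contexts make the induction work for products: \<open>t\<close> joins the right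
  context while \<open>s\<close> is expanded into words, then a word of \<open>s\<close> joins the
  left context while \<open>t\<close> is expanded.\<close>

lemma term_in_context_below:
  assumes "\<And>w. w \<in> lang t \<Longrightarrow> below E (opt_times_left p (opt_times_right q (word_term w))) r"
  shows "below E (opt_times_left p (opt_times_right q t)) r"
  using assms
proof (induction t arbitrary: p q)
  case (Plus s t)
  have "follows E (opt_times_right q (Plus s t)) (Plus (opt_times_right q s) (opt_times_right q t))"
    by (cases q) (auto intro: distrib_right follows.refl)
  then have "follows E (opt_times_left p (opt_times_right q (Plus s t)))
      (Plus (opt_times_left p (opt_times_right q s)) (opt_times_left p (opt_times_right q t)))"
    by (cases p) (auto intro: follows.trans[OF follows.times[OF follows.refl] distrib_left])
  moreover have "below E (Plus (opt_times_left p (opt_times_right q s))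
      (opt_times_left p (opt_times_right q t))) r"
    using Plus by (intro plus_below) auto
  ultimately show ?case
    by (rule follows_below_trans)
next
  case (Times s t)
  have left: "follows E (opt_times_left p (opt_times_right (Some (opt_times_right q b)) a))
      (opt_times_left p (opt_times_right q (Times a b)))" for a b
    by (cases p; cases q) (auto intro: follows.times follows.refl follows.sym[OF times_assoc])
  have right: "follows E (opt_times_left (Some (opt_times_left p a)) (opt_times_right q b))
      (opt_times_left p (opt_times_right q (Times a b)))" for a b
    by (cases p; cases q)
      (auto intro: follows.times follows.refl follows.sym[OF times_assoc] times_assoc
        follows.trans[OF times_assoc follows.times[OF follows.refl follows.sym[OF times_assoc]]])
  have "below E (opt_times_left p (opt_times_right q (Times s t))) r"
    if "below E (opt_times_left p (opt_times_right (Some (opt_times_right q t)) s)) r"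
    using follows_below_trans[OF follows.sym[OF left] that] .
  moreover have "below E (opt_times_left p (opt_times_right (Some (opt_times_right q t)) s)) r"
  proof (rule Times.IH(1))
    fix v assume v: "v \<in> lang s"
    have "below E (opt_times_left (Some (opt_times_left p (word_term v))) (opt_times_right q t)) r"
    proof (rule Times.IH(2))
      fix w assume w: "w \<in> lang t"
      have "v \<noteq> []" "w \<noteq> []"
        using v w Nil_notin_lang by auto
      then have "follows E (Times (word_term v) (word_term w)) (word_term (v @ w))"
        by (simp add: word_term_append follows.sym)
      then have "follows E
          (opt_times_left (Some (opt_times_left p (word_term v))) (opt_times_right q (word_term w)))
          (opt_times_left p (opt_times_right q (word_term (v @ w))))"
        using right opt_times_follows follows.trans by blast
      moreover have "below E (opt_times_left p (opt_times_right q (word_term (v @ w)))) r"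
        using v w by (intro Times.prems) auto
      ultimately show "below E (opt_times_left (Some (opt_times_left p (word_term v)))
          (opt_times_right q (word_term w))) r"
        by (rule follows_below_trans)
    qed
    then show "below E (opt_times_left p (opt_times_right (Some (opt_times_right q t))
        (word_term v))) r"
      using follows_below_trans[OF follows.trans[OF left follows.sym[OF right]]] by blast
  qed
  ultimately show ?case
    by blast
qed simp

lemma term_below: "(\<And>w. w \<in> lang t \<Longrightarrow> below E (word_term w) r) \<Longrightarrow> below E t r"
  using term_in_context_below[of t None None r] by simp

lemma followsI:
  assumes "\<And>w. w \<in> lang u \<Longrightarrow> below E (word_term w) v" "\<And>w. w \<in> lang v \<Longrightarrow> below E (word_term w) u"
  shows "follows E u v"
  using assms by (rule below_antisym[OF term_below term_below])

lemma suffix_below: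
  assumes "\<And>s t. below E t (Times s t)" "w \<noteq> []"
  shows "below E (word_term w) (word_term (v @ w))"
proof (cases "v = []")
  case False
  then show ?thesis
    by (rule below_follows_trans[OF assms(1) follows.sym[OF word_term_append[OF _ assms(2)]]])
qed (simp add: below_refl)

lemma prefix_below:
  assumes "\<And>s t. below E s (Times s t)" "v \<noteq> []"
  shows "below E (word_term v) (word_term (v @ w))"
proof (cases "w = []")
  case False
  then show ?thesis
    by (rule below_follows_trans[OF assms(1) follows.sym[OF word_term_append[OF assms(2)]]])
qed (simp add: below_refl)

end

text \<open>An identity amounts to two inequalities, and the distributive laws reduce the left side
  of each to single words.\<close>

lemma bool_finitely_basedI:
  assumes "finite E" "ai_semiring_identities \<subseteq> E" "\<And>u v. (u, v) \<in> E \<Longrightarrow> bholds m n u v"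
    and "\<And>u v w. ai_semiring_theory E \<Longrightarrow> bholds m n u v \<Longrightarrow> w \<in> lang u \<Longrightarrow> below E (word_term w) v"
  shows "bool_finitely_based m n"
proof -
  interpret ai_semiring_theory E
    by unfold_locales (rule assms(2))
  have "follows E u v" if h: "bholds m n u v" for u v
  proof (rule followsI)
    have "bholds m n v u"
      using h by (simp add: bholds_def)
    then show "below E (word_term w) u" if "w \<in> lang v" for w
      using that assms(4)[OF ai_semiring_theory_axioms] by blast
  qed (use h assms(4)[OF ai_semiring_theory_axioms] in blast)
  then show ?thesis
    unfolding bool_finitely_based_def using assms(1,3) by blast
qed

section \<open>One finite basis for each product other than the meet\<close>

lemma not_single_imp_long: "w \<noteq> [] \<Longrightarrow> length w \<noteq> 1 \<Longrightarrow> \<exists>x y r. w = x # y # r"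
  by (cases w rule: remdups_adj.cases) auto

text \<open>Words of length at least two vanish, so the basis puts every product below everything;
  only single letters have to match.\<close>

lemma False_finitely_based:
  assumes "n \<ge> 1"
  shows "bool_finitely_based (\<lambda>_ _. False) n"
proof -
  define E where "E = insert (Plus (Times (Var 0) (Var 1)) (Var 2), Var 2) ai_semiring_identities"
  show ?thesis
  proof (rule bool_finitely_basedI[of E])
    show "finite E" "ai_semiring_identities \<subseteq> E"
      by (auto simp: E_def ai_semiring_identities_def)
    show "bholds (\<lambda>_ _. False) n u v" if "(u, v) \<in> E" for u v
      using that by (auto simp: E_def bholds_def ai_semiring_identities_def)
    fix u v w
    assume "ai_semiring_theory E" and uv: "bholds (\<lambda>_ _. False) n u v" and w: "w \<in> lang u"
    interpret ai_semiring_theory E by fact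
    have sem: "beval (\<lambda>_ _. False) n R t i j \<longleftrightarrow> (\<exists>w\<in>lang t. length w = 1 \<and> R (hd w) i j)"
      if "i < n" "j < n" for R t i j
      using that by (intro beval_words) (auto simp: Suc_length_conv neq_Nil_conv)
    show "below E (word_term w) v"
    proof (cases "length w = 1")
      case True
      define R :: "nat \<Rightarrow> nat \<Rightarrow> nat \<Rightarrow> bool" where "R = (\<lambda>z _ _. z = hd w)"
      have "beval (\<lambda>_ _. False) n R u 0 0"
        using w True assms by (auto simp: sem R_def)
      then have "beval (\<lambda>_ _. False) n R v 0 0"
        using uv assms by (simp add: bholds_def)
      then obtain w' where w': "w' \<in> lang v" "length w' = 1" "hd w' = hd w"
        using assms by (auto simp: sem R_def)
      then show ?thesis
        using True word_below[OF w'(1)] w' by (auto simp: length_Suc_conv)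
    next
      case False
      then obtain x y r where "w = x # y # r"
        using not_single_imp_long w Nil_notin_lang by metis
      then show ?thesis
        using below_instance[of "Times (Var 0) (Var 1)" "Var 2" "[Var x, word_term (y # r), v]"]
        by (simp add: E_def)
    qed
  qed
qed

text \<open>Words of length at least two give the full matrix, so the basis puts everything below
  every product.\<close>

lemma True_finitely_based:
  assumes "n \<ge> 1"
  shows "bool_finitely_based (\<lambda>_ _. True) n"
proof -
  define E where "E =
    insert (Plus (Var 0) (Times (Var 1) (Var 2)), Times (Var 1) (Var 2)) ai_semiring_identities"
  show ?thesis
  proof (rule bool_finitely_basedI[of E])
    show "finite E" "ai_semiring_identities \<subseteq> E"
      by (auto simp: E_def ai_semiring_identities_def)
    show "bholds (\<lambda>_ _. True) n u v" if "(u, v) \<in> E" for u v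
      using that by (auto simp: E_def bholds_def ai_semiring_identities_def)
    fix u v w
    assume "ai_semiring_theory E" and uv: "bholds (\<lambda>_ _. True) n u v" and w: "w \<in> lang u"
    interpret ai_semiring_theory E by fact
    have sem: "beval (\<lambda>_ _. True) n R t i j \<longleftrightarrow> (\<exists>w\<in>lang t. length w = 1 \<longrightarrow> R (hd w) i j)"
      if "i < n" "j < n" for R t i j
      using that assms by (intro beval_words) (auto simp: Suc_length_conv neq_Nil_conv)
    \<comment> \<open>For a long \<open>w\<close> all matrices are zero, and only a long word of
      \<open>v\<close> can be true; for a single letter that letter may match too.\<close>
    define R :: "nat \<Rightarrow> nat \<Rightarrow> nat \<Rightarrow> bool" where "R = (\<lambda>z _ _. length w = 1 \<and> z = hd w)"
    have "beval (\<lambda>_ _. True) n R u 0 0"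
      using w assms by (auto simp: sem R_def)
    then have "beval (\<lambda>_ _. True) n R v 0 0"
      using uv assms by (simp add: bholds_def)
    then obtain w' where w': "w' \<in> lang v" "length w' = 1 \<longrightarrow> length w = 1 \<and> hd w' = hd w"
      using assms by (auto simp: sem R_def)
    show "below E (word_term w) v"
    proof (cases "length w' = 1")
      case True
      then show ?thesis
        using True word_below[OF w'(1)] w' by (auto simp: length_Suc_conv)
    next
      case False
      then obtain x y r where "w' = x # y # r"
        using not_single_imp_long w'(1) Nil_notin_lang by metis
      then have "below E (word_term w) (word_term w')"
        using below_instance[of "Var 0" "Times (Var 1) (Var 2)" "[word_term w, Var x, word_term (y # r)]"]
        by (simp add: E_def)
      then show ?thesis
        using below_trans word_below w'(1) by blast
    qed
  qed
qed

text \<open>A long word has the row spread of its first letter as value. The laws allow everything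
  after the first letter of a product to be exchanged, and a letter to be extended to the
  right.\<close>

lemma left_finitely_based:
  assumes "n \<ge> 2"
  shows "bool_finitely_based (\<lambda>a b. a) n"
proof -
  define E where "E = {(Plus (Times (Var 0) (Var 1)) (Times (Var 0) (Var 2)), Times (Var 0) (Var 2)),
    (Plus (Var 0) (Times (Var 0) (Var 1)), Times (Var 0) (Var 1))} \<union> ai_semiring_identities"
  show ?thesis
  proof (rule bool_finitely_basedI[of E])
    show "finite E" "ai_semiring_identities \<subseteq> E"
      by (auto simp: E_def ai_semiring_identities_def)
    show "bholds (\<lambda>a b. a) n u v" if "(u, v) \<in> E" for u v
      using that by (auto simp: E_def bholds_def ai_semiring_identities_def)
    fix u v w
    assume "ai_semiring_theory E" and uv: "bholds (\<lambda>a b. a) n u v" and w: "w \<in> lang u"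
    interpret ai_semiring_theory E by fact
    have law1: "below E (Times r s) (Times r t)" for r s t
      using below_instance[of "Times (Var 0) (Var 1)" "Times (Var 0) (Var 2)" "[r, s, t]"]
      by (simp add: E_def)
    have law2: "below E s (Times s t)" for s t
      using below_instance[of "Var 0" "Times (Var 0) (Var 1)" "[s, t]"] by (simp add: E_def)
    have sem: "beval (\<lambda>a b. a) n R t i j \<longleftrightarrow>
        (\<exists>w\<in>lang t. if length w = 1 then R (hd w) i j else \<exists>k<n. R (hd w) i k)"
      if "i < n" "j < n" for R t i j
      using that by (intro beval_words) (auto simp: Suc_length_conv neq_Nil_conv)
    \<comment> \<open>At this matrix unit, entry (0, 1) is false for single letters and true for
      long words with the right first letter; this is where \<open>n >= 2\<close> enters.\<close>
    define R :: "nat \<Rightarrow> nat \<Rightarrow> nat \<Rightarrow> bool" where "R = (\<lambda>z i j. z = hd w \<and> i = 0 \<and> j = 0)"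
    have wne: "w \<noteq> []"
      using w Nil_notin_lang by auto
    show "below E (word_term w) v"
    proof (cases "length w = 1")
      case True
      have "beval (\<lambda>a b. a) n R u 0 0"
        using w True assms by (auto simp: sem R_def)
      then have "beval (\<lambda>a b. a) n R v 0 0"
        using uv assms by (simp add: bholds_def)
      then obtain w' where w': "w' \<in> lang v" "hd w' = hd w"
        using assms by (auto simp: sem R_def split: if_splits)
      then have "w' = w @ tl w'"
        using True Nil_notin_lang by (cases w') (auto simp: length_Suc_conv)
      then have "below E (word_term w) (word_term w')"
        using prefix_below[OF law2 wne] by metis
      then show ?thesis
        using below_trans word_below w'(1) by blast
    next
      case False
      have "\<exists>k<n. R (hd w) 0 k"
        using assms by (auto simp: R_def)
      then have "beval (\<lambda>a b. a) n R u 0 1"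
        using w False assms by (auto simp: sem)
      then have "beval (\<lambda>a b. a) n R v 0 1"
        using uv assms by (simp add: bholds_def)
      then obtain w' where w': "w' \<in> lang v" "length w' \<noteq> 1" "hd w' = hd w"
        using assms by (auto simp: sem R_def split: if_splits)
      then obtain x y r y' r' where "w = x # y # r" "w' = x # y' # r'"
        using not_single_imp_long[OF wne False] not_single_imp_long[OF _ w'(2)] Nil_notin_lang
        by (metis list.sel(1))
      then have "below E (word_term w) (word_term w')"
        using law1 by simp
      then show ?thesis
        using below_trans word_below w'(1) by blast
    qed
  qed
qed

text \<open>The mirror image of the left projection: last letters and columns replace first letters
  and rows.\<close>

lemma right_finitely_based:
  assumes "n \<ge> 2"
  shows "bool_finitely_based (\<lambda>a b. b) n"
proof -
  define E where "E = {(Plus (Times (Var 1) (Var 0)) (Times (Var 2) (Var 0)), Times (Var 2) (Var 0)),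
    (Plus (Var 0) (Times (Var 1) (Var 0)), Times (Var 1) (Var 0))} \<union> ai_semiring_identities"
  show ?thesis
  proof (rule bool_finitely_basedI[of E])
    show "finite E" "ai_semiring_identities \<subseteq> E"
      by (auto simp: E_def ai_semiring_identities_def)
    show "bholds (\<lambda>a b. b) n u v" if "(u, v) \<in> E" for u v
      using that by (auto simp: E_def bholds_def ai_semiring_identities_def)
    fix u v w
    assume "ai_semiring_theory E" and uv: "bholds (\<lambda>a b. b) n u v" and w: "w \<in> lang u"
    interpret ai_semiring_theory E by fact
    have law1: "below E (Times s r) (Times t r)" for r s t
      using below_instance[of "Times (Var 1) (Var 0)" "Times (Var 2) (Var 0)" "[r, s, t]"]
      by (simp add: E_def)
    have law2: "below E s (Times t s)" for s t
      using below_instance[of "Var 0" "Times (Var 1) (Var 0)" "[s, t]"] by (simp add: E_def)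
    have sem: "beval (\<lambda>a b. b) n R t i j \<longleftrightarrow>
        (\<exists>w\<in>lang t. if length w = 1 then R (last w) i j else \<exists>k<n. R (last w) k j)"
      if "i < n" "j < n" for R t i j
      using that by (intro beval_words) (auto simp: Suc_length_conv neq_Nil_conv)
    define R :: "nat \<Rightarrow> nat \<Rightarrow> nat \<Rightarrow> bool" where "R = (\<lambda>z i j. z = last w \<and> i = 0 \<and> j = 0)"
    have wne: "w \<noteq> []"
      using w Nil_notin_lang by auto
    show "below E (word_term w) v"
    proof (cases "length w = 1")
      case True
      have "beval (\<lambda>a b. b) n R u 0 0"
        using w True assms by (auto simp: sem R_def)
      then have "beval (\<lambda>a b. b) n R v 0 0"
        using uv assms by (simp add: bholds_def)
      then obtain w' where w': "w' \<in> lang v" "last w' = last w"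
        using assms by (auto simp: sem R_def split: if_splits)
      then have "w' = butlast w' @ w"
        using True Nil_notin_lang[of v] by (cases w' rule: rev_cases) (auto simp: length_Suc_conv)
      then have "below E (word_term w) (word_term w')"
        using suffix_below[OF law2 wne] by metis
      then show ?thesis
        using below_trans word_below w'(1) by blast
    next
      case False
      have "\<exists>k<n. R (last w) k 0"
        using assms by (auto simp: R_def)
      then have "beval (\<lambda>a b. b) n R u 1 0"
        using w False assms by (auto simp: sem)
      then have "beval (\<lambda>a b. b) n R v 1 0"
        using uv assms by (simp add: bholds_def)
      then obtain w' where w': "w' \<in> lang v" "length w' \<noteq> 1" "last w' = last w"
        using assms by (auto simp: sem R_def split: if_splits)
      \<comment> \<open>\<open>word_term\<close> nests to the right, so the last letter has to be
        split off explicitly.\<close>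
      have split: "z = butlast z @ [last z] \<and> butlast z \<noteq> []" if "z \<noteq> []" "length z \<noteq> 1" for z :: "nat list"
        using not_single_imp_long[OF that] by auto
      have "w' \<noteq> []"
        using w'(1) Nil_notin_lang by auto
      then have "follows E (word_term w') (Times (word_term (butlast w')) (Var (last w)))"
        using word_term_append[of "butlast w'" "[last w']"] split[of w'] w'(2,3) by simp
      moreover have "follows E (word_term w) (Times (word_term (butlast w)) (Var (last w)))"
        using word_term_append[of "butlast w" "[last w]"] split[of w] wne False by simp
      ultimately have "below E (word_term w) (word_term w')"
        using follows_below_trans below_follows_trans[OF law1 follows.sym] by blast
      then show ?thesis
        using below_trans word_below w'(1) by blast
    qed
  qed
qed

text \<open>
  For \<open>n \<times> n\<close> matrices over the semiring with product \<open>+\<close>, the value of a word of length at least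
  two consists of the row spread of its first letter, the column spread of its last letter and the
  full spread of the letters in between.
\<close>

definition spread_word :: "nat \<Rightarrow> (nat \<Rightarrow> nat \<Rightarrow> nat \<Rightarrow> bool) \<Rightarrow> nat list \<Rightarrow> nat \<Rightarrow> nat \<Rightarrow> bool" where
  "spread_word n R w i j \<longleftrightarrow>
     (if length w = 1 then R (hd w) i j
      else (\<exists>k<n. R (hd w) i k) \<or> (\<exists>k<n. R (last w) k j) \<or>
        (\<exists>x\<in>set (butlast (tl w)). \<exists>k<n. \<exists>l<n. R x k l))"

text \<open>Entry (i, j) of the product joins all of row \<open>i\<close> of the left factor with
  all of column \<open>j\<close> of the right one. This spreads the last letter of a longer
  \<open>v\<close> and the first letter of a longer \<open>w\<close> fully, turning them into inner
  letters.\<close>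

lemma spread_word_append:
  assumes "v \<noteq> []" "w \<noteq> []" "i < n" "j < n"
  shows "spread_word n R (v @ w) i j \<longleftrightarrow> (\<exists>k<n. spread_word n R v i k \<or> spread_word n R w k j)"
proof -
  have v: "(\<exists>k<n. spread_word n R v i k) \<longleftrightarrow>
      (\<exists>k<n. R (hd v) i k) \<or> (\<exists>x\<in>set (tl v). \<exists>k<n. \<exists>l<n. R x k l)"
  proof (cases "length v = 1")
    case False
    then obtain x r y where "v = x # r @ [y]"
      using assms(1) by (metis append_butlast_last_id length_Cons list.exhaust list.size(3) One_nat_def)
    then show ?thesis
      using assms(3) by (auto simp: spread_word_def)
  qed (auto simp: spread_word_def length_Suc_conv)
  have w: "(\<exists>k<n. spread_word n R w k j) \<longleftrightarrow>
      (\<exists>k<n. R (last w) k j) \<or> (\<exists>x\<in>set (butlast w). \<exists>k<n. \<exists>l<n. R x k l)"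
  proof (cases "length w = 1")
    case False
    then obtain x r y where "w = x # r @ [y]"
      using assms(2) by (metis append_butlast_last_id length_Cons list.exhaust list.size(3) One_nat_def)
    then show ?thesis
      using assms(4) by (auto simp: spread_word_def)
  qed (auto simp: spread_word_def length_Suc_conv)
  have "length (v @ w) \<noteq> 1" "hd (v @ w) = hd v" "last (v @ w) = last w"
    "set (butlast (tl (v @ w))) = set (tl v) \<union> set (butlast w)"
    using assms(1,2) by (cases v; cases w; simp add: butlast_append)+
  then have "spread_word n R (v @ w) i j \<longleftrightarrow>
      (\<exists>k<n. spread_word n R v i k) \<or> (\<exists>k<n. spread_word n R w k j)"
    unfolding v w spread_word_def[of n R "v @ w"] by auto
  then show ?thesis
    by blast
qed

lemma in_butlast_tl_split:
  assumes "c \<in> set (butlast (tl w))"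
  obtains p r where "w = p @ c # r" "p \<noteq> []" "r \<noteq> []"
proof -
  obtain x y t where w: "w = x # t @ [y]"
    using assms by (metis append_butlast_last_id butlast.simps(1) empty_iff list.exhaust_sel list.sel(2) list.set(1))
  then obtain p r where "t = p @ c # r"
    using assms by (auto dest: split_list)
  then show ?thesis
    using w that[of "x # p" "r @ [y]"] by simp
qed

text \<open>The first two laws drop prefixes and suffixes; the third combines a first and a last
  letter found in different words, the fourth also an inner letter, and the fifth collects several
  inner letters.\<close>

lemma disj_finitely_based:
  assumes "n \<ge> 2"
  shows "bool_finitely_based (\<or>) n"
proof -
  define E where "E = (\<lambda>(s, t). (Plus s t, t)) `
    {(Var 0, Times (Var 0) (Var 1)),
     (Var 1, Times (Var 0) (Var 1)),
     (Times (Var 0) (Var 1), Plus (Times (Var 0) (Var 2)) (Times (Var 3) (Var 1))),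
     (Times (Var 0) (Times (Var 1) (Var 2)),
      Plus (Times (Var 0) (Var 3)) (Plus (Times (Var 4) (Times (Var 1) (Var 5))) (Times (Var 6) (Var 2)))),
     (Times (Var 0) (Times (Var 1) (Times (Var 2) (Var 3))),
      Plus (Times (Var 0) (Times (Var 1) (Var 3))) (Times (Var 0) (Times (Var 2) (Var 3))))}
    \<union> ai_semiring_identities"
  show ?thesis
  proof (rule bool_finitely_basedI[of E])
    show "finite E" "ai_semiring_identities \<subseteq> E"
      by (auto simp: E_def ai_semiring_identities_def)
    show "bholds (\<or>) n u v" if "(u, v) \<in> E" for u v
      using that assms unfolding E_def bholds_def ai_semiring_identities_def
      by (elim UnE imageE insertE emptyE) auto
    fix u v w
    assume "ai_semiring_theory E" and uv: "bholds (\<or>) n u v" and w: "w \<in> lang u"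
    interpret ai_semiring_theory E by fact
    have law1: "below E s (Times s t)" for s t
      using below_instance[of "Var 0" "Times (Var 0) (Var 1)" "[s, t]"] by (simp add: E_def)
    have law2: "below E t (Times s t)" for s t
      using below_instance[of "Var 1" "Times (Var 0) (Var 1)" "[s, t]"] by (simp add: E_def)
    have law3: "below E (Times a b) (Plus (Times a s) (Times t b))" for a b s t
      using below_instance[of "Times (Var 0) (Var 1)"
          "Plus (Times (Var 0) (Var 2)) (Times (Var 3) (Var 1))" "[a, b, s, t]"] by (simp add: E_def)
    have law4: "below E (Times a (Times c b))
        (Plus (Times a s) (Plus (Times p (Times c q)) (Times t b)))" for a b c p q s t
      using below_instance[of "Times (Var 0) (Times (Var 1) (Var 2))"
          "Plus (Times (Var 0) (Var 3)) (Plus (Times (Var 4) (Times (Var 1) (Var 5))) (Times (Var 6) (Var 2)))"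
          "[a, c, b, s, p, q, t]"] by (simp add: E_def)
    have law5: "below E (Times a (Times c (Times d b))) (Plus (Times a (Times c b)) (Times a (Times d b)))"
      for a b c d
      using below_instance[of "Times (Var 0) (Times (Var 1) (Times (Var 2) (Var 3)))"
          "Plus (Times (Var 0) (Times (Var 1) (Var 3))) (Times (Var 0) (Times (Var 2) (Var 3)))"
          "[a, c, d, b]"] by (simp add: E_def)
    have sem: "beval (\<or>) n R t i j \<longleftrightarrow> (\<exists>w\<in>lang t. spread_word n R w i j)"
      if "i < n" "j < n" for R t i j
      using that by (intro beval_words spread_word_append) (auto simp: spread_word_def)
    \<comment> \<open>For this matrix unit, entry (0, 0) detects any occurrence of \<open>a\<close>.
      In long words, (0, 1) detects it as first or inner letter, (1, 0) as last or inner letter, and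
      (1, 1) as inner letter; these three are false for single letters.\<close>
    define R :: "nat \<Rightarrow> nat \<Rightarrow> nat \<Rightarrow> nat \<Rightarrow> bool" where "R a z i j \<longleftrightarrow> z = a \<and> i = 0 \<and> j = 0" for a z i j
    have test: "\<exists>w'\<in>lang v. spread_word n (R a) w' i j"
      if "spread_word n (R a) w i j" "i < 2" "j < 2" for a i j
    proof -
      have "beval (\<or>) n (R a) u i j"
        using that w assms by (auto simp: sem)
      then show ?thesis
        using uv that assms by (auto simp: bholds_def sem)
    qed
    show "below E (word_term w) v"
    proof (cases "length w = 1")
      case True
      then obtain a where a: "w = [a]"
        by (auto simp: length_Suc_conv)
      then have "spread_word n (R a) w 0 0"
        by (simp add: spread_word_def R_def)
      then obtain w' where w': "w' \<in> lang v" "spread_word n (R a) w' 0 0"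
        using test by force
      then have "w' \<noteq> []"
        using Nil_notin_lang by auto
      have "a \<in> set w'"
        using w'(2) \<open>w' \<noteq> []\<close> hd_in_set[of w'] last_in_set[of w']
        by (auto simp: spread_word_def R_def split: if_splits dest!: in_set_butlastD list.set_sel(2)[rotated])
      then obtain p r where "w' = p @ [a] @ r"
        by (auto dest: split_list)
      then have "below E (word_term w) (word_term w')"
        using below_trans[OF prefix_below[OF law1, of "[a]" r] suffix_below[OF law2, of "[a] @ r" p]] a
        by simp
      then show ?thesis
        using below_trans word_below w'(1) by blast
    next
      case False
      have "w \<noteq> []"
        using w Nil_notin_lang by auto
      then obtain a M b where wab: "w = a # M @ [b]"
        using False by (metis append_butlast_last_id length_Cons list.exhaust list.size(3) One_nat_def)
      obtain s where s: "below E (Times (Var a) s) v"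
      proof -
        have "spread_word n (R a) w 0 1"
          using assms by (auto simp: wab spread_word_def R_def)
        then obtain w' where w': "w' \<in> lang v" "spread_word n (R a) w' 0 1"
          using test by force
        then have ne: "w' \<noteq> []" and l: "length w' \<noteq> 1"
          using Nil_notin_lang by (auto simp: spread_word_def R_def)
        have "hd w' = a \<or> a \<in> set (butlast (tl w'))"
          using w'(2) l by (auto simp: spread_word_def R_def)
        \<comment> \<open>First or inner, \<open>a\<close> is followed by some letter; dropping the
          prefix leaves a product with left factor \<open>a\<close>.\<close>
        then obtain p r where pr: "w' = p @ a # r" "r \<noteq> []"
        proof
          assume "hd w' = a"
          then show thesis
            using not_single_imp_long[OF ne l] that[of "[]"] by auto
        next
          assume "a \<in> set (butlast (tl w'))"
          then show thesis
            using that by (rule in_butlast_tl_split)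
        qed
        have "below E (word_term (a # r)) v"
          using below_trans[OF suffix_below[OF law2, of "a # r" p] word_below[OF w'(1)[unfolded pr(1)]]]
          by simp
        then show thesis
          using pr(2) that by (cases r) auto
      qed
      obtain t where t: "below E (Times t (Var b)) v"
      proof -
        have "spread_word n (R b) w 1 0"
          using assms by (auto simp: wab spread_word_def R_def)
        then obtain w' where w': "w' \<in> lang v" "spread_word n (R b) w' 1 0"
          using test by force
        then have ne: "w' \<noteq> []" and l: "length w' \<noteq> 1"
          using Nil_notin_lang by (auto simp: spread_word_def R_def)
        have "last w' = b \<or> b \<in> set (butlast (tl w'))"
          using w'(2) l by (auto simp: spread_word_def R_def)
        then obtain p r where pr: "w' = (p @ [b]) @ r" "p \<noteq> []"
        proof
          assume "last w' = b"
          then show thesis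
            using not_single_imp_long[OF ne l] that[of "butlast w'" "[]"] append_butlast_last_id[OF ne]
            by auto
        next
          assume "b \<in> set (butlast (tl w'))"
          then show thesis
            using that by (elim in_butlast_tl_split) auto
        qed
        have "below E (Times (word_term p) (Var b)) (word_term (p @ [b]))"
          using follows_below[OF follows.sym[OF word_term_append[of p "[b]"]]] pr(2) by simp
        also have "below E \<dots> v"
          using below_trans[OF prefix_below[OF law1, of "p @ [b]" r] word_below[OF w'(1)[unfolded pr(1)]]]
          by simp
        finally show thesis
          by (rule that)
      qed
      have mid: "\<exists>p q. below E (Times p (Times (Var c) q)) v" if "c \<in> set M" for c
      proof -
        have "spread_word n (R c) w 1 1"
          using assms that by (auto simp: wab spread_word_def R_def)
        then obtain w' where w': "w' \<in> lang v" "spread_word n (R c) w' 1 1"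
          using test by force
        then have "c \<in> set (butlast (tl w'))"
          by (auto simp: spread_word_def R_def split: if_splits)
        then obtain p r where pr: "w' = p @ c # r" "p \<noteq> []" "r \<noteq> []"
          by (rule in_butlast_tl_split)
        have "below E (Times (word_term p) (word_term (c # r))) (word_term w')"
          using follows_below[OF follows.sym[OF word_term_append[of p "c # r"]]] pr by simp
        also have "below E \<dots> v"
          by (rule word_below[OF w'(1)])
        finally have "below E (Times (word_term p) (word_term (c # r))) v" .
        moreover have "word_term (c # r) = Times (Var c) (word_term r)"
          using pr(3) by (cases r) auto
        ultimately show ?thesis
          by auto
      qed
      \<comment> \<open>Inner letters are inserted one at a time between \<open>a\<close> and
        \<open>b\<close>: \<open>law4\<close> inserts \<open>c\<close> alone, and
        \<open>law5\<close> merges it with those already there.\<close>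
      have "below E (word_term (a # M @ [b])) v"
        using mid
      proof (induction M)
        case Nil
        show ?case
          using below_trans[OF law3 plus_below[OF s t]] by simp
      next
        case (Cons c M)
        obtain p q where pq: "below E (Times p (Times (Var c) q)) v"
          using Cons.prems[of c] by auto
        have acb: "below E (Times (Var a) (Times (Var c) (Var b))) v"
          using below_trans[OF law4 plus_below[OF s plus_below[OF pq t]]] .
        show ?case
        proof (cases M)
          case Nil
          then show ?thesis
            using acb by simp
        next
          case (Cons d M')
          have "follows E (word_term (M @ [b])) (Times (word_term M) (Var b))"
            using word_term_append[of M "[b]"] Cons by simp
          then have M: "follows E (Times (Var a) (word_term (M @ [b]))) (Times (Var a) (Times (word_term M) (Var b)))"
            "follows E (Times (Var a) (Times (Var c) (word_term (M @ [b]))))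
              (Times (Var a) (Times (Var c) (Times (word_term M) (Var b))))"
            by (auto intro: follows.times follows.refl)
          have "below E (word_term (a # M @ [b])) v"
            using Cons.IH Cons.prems by simp
          then have "below E (Times (Var a) (word_term (M @ [b]))) v"
            using \<open>M = d # M'\<close> by simp
          then have "below E (Times (Var a) (Times (word_term M) (Var b))) v"
            using below_trans[OF follows_below[OF follows.sym[OF M(1)]]] by blast
          then have "below E (Times (Var a) (Times (Var c) (Times (word_term M) (Var b)))) v"
            using below_trans[OF law5 plus_below[OF acb]] by blast
          then have "below E (Times (Var a) (Times (Var c) (word_term (M @ [b])))) v"
            using below_trans[OF follows_below[OF M(2)]] by blast
          then show ?thesis
            using \<open>M = d # M'\<close> by simp
        qed
      qed
      then show ?thesis
        by (simp add: wab)
    qed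
  qed
qed

section \<open>Two-element ai-semirings\<close>

text \<open>Idempotence and commutativity make addition a maximum. Distributivity then says that the
  product is monotone in each argument, and there are six monotone binary Boolean
  operations.\<close>

lemma two_element_ai_semiring:
  assumes "card (UNIV :: 'a::ai_semiring set) = 2"
  obtains T :: "'a::ai_semiring \<Rightarrow> bool" and m where
    "\<And>x y. T (x + y) = (T x \<or> T y)" "\<And>x y. T (x * y) = m (T x) (T y)" "bij T"
    "m \<in> {\<lambda>_ _. False, \<lambda>_ _. True, \<lambda>p q. p, \<lambda>p q. q, (\<or>), (\<and>)}"
    "is_distributive_lattice TYPE('a) \<longleftrightarrow> m = (\<and>)"
proof -
  obtain a b :: 'a where ab: "UNIV = {a, b}" "a \<noteq> b"
    using assms by (auto simp: card_2_iff)
  have "a + b \<in> {a, b}"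
    using ab(1) by blast
  \<comment> \<open>The sum of the two elements is one of them; it is named \<open>t\<close> and the
    other \<open>z\<close>.\<close>
  then obtain z t :: 'a where zt: "UNIV = {z, t}" "z \<noteq> t" "z + t = t"
    using ab by (metis add.commute insert_commute insertE singletonD)
  have zt_cases: "x = z \<or> x = t" for x
    using zt(1) by blast
  have add [simp]: "z + t = t" "t + z = t" "z + z = z" "t + t = t"
    using zt(3) by (simp_all add: add.commute add_idem)
  define T where "T x \<longleftrightarrow> x = t" for x
  define m where "m p q = T ((if p then t else z) * (if q then t else z))" for p q
  have T_add: "T (x + y) = (T x \<or> T y)" for x y
    using zt_cases[of x] zt_cases[of y] zt(2) by (auto simp: T_def)
  have T_mult: "T (x * y) = m (T x) (T y)" for x y
    using zt_cases[of x] zt_cases[of y] zt(2) by (auto simp: T_def m_def)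
  have T_inj: "x = y \<longleftrightarrow> T x = T y" for x y
    using zt_cases[of x] zt_cases[of y] zt(2) by (auto simp: T_def)
  have Tz: "\<not> T z" and Tt: "T t"
    using zt(2) by (simp_all add: T_def)
  have bij: "bij T"
    using Tz Tt T_inj by (intro bijI injI surjI[of T "\<lambda>p. if p then t else z"]) auto
  have left: "m p (q \<or> r) = (m p q \<or> m p r)" for p q r
  proof -
    have "T (x * (y + w)) = T (x * y + x * w)" for x y w
      by (simp add: distrib_left)
    from this[of "if p then t else z" "if q then t else z" "if r then t else z"] show ?thesis
      using Tz Tt by (simp add: T_add T_mult split: if_splits)
  qed
  have right: "m (p \<or> q) r = (m p r \<or> m q r)" for p q r
  proof -
    have "T ((x + y) * w) = T (x * w + y * w)" for x y w
      by (simp add: distrib_right)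
    from this[of "if p then t else z" "if q then t else z" "if r then t else z"] show ?thesis
      using Tz Tt by (simp add: T_add T_mult split: if_splits)
  qed
  \<comment> \<open>These four instances express monotonicity along the four edges of the Boolean
    square.\<close>
  have "m \<in> {\<lambda>_ _. False, \<lambda>_ _. True, \<lambda>p q. p, \<lambda>p q. q, (\<or>), (\<and>)}"
    using left[of False False True] left[of True False True]
      right[of False True False] right[of False True True]
    by (auto simp: fun_eq_iff all_bool_eq)
  moreover have "is_distributive_lattice TYPE('a) \<longleftrightarrow> m = (\<and>)"
  proof
    assume "is_distributive_lattice TYPE('a)"
    then interpret d: distrib_lattice "(*) :: 'a \<Rightarrow> 'a \<Rightarrow> 'a"
      "\<lambda>x y. x + y = y" "\<lambda>x y. x + y = y \<and> x \<noteq> y" "(+)"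
      by (simp add: is_distributive_lattice_def)
    \<comment> \<open>As \<open>z\<close> is below \<open>t\<close>, absorption and idempotence of
      the meet fix all four products.\<close>
    have "x * y = t \<longleftrightarrow> x = t \<and> y = t" for x y
      using zt_cases[of x] zt_cases[of y] d.inf_absorb1[of z t] d.inf_absorb2[of z t]
        d.inf_idem[of z] d.inf_idem[of t] zt(2) by auto
    then show "m = (\<and>)"
      using zt(2) zt_cases by (auto simp: fun_eq_iff m_def T_def)
  next
    assume m: "m = (\<and>)"
    have "class.distrib_lattice ((*) :: 'a \<Rightarrow> 'a \<Rightarrow> 'a)
        (\<lambda>x y. x + y = y) (\<lambda>x y. x + y = y \<and> x \<noteq> y) (+)"
      by unfold_locales (auto simp: T_inj T_add T_mult m)
    then show "is_distributive_lattice TYPE('a)"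
      by (simp add: is_distributive_lattice_def)
  qed
  ultimately show thesis
    by (rule that[OF T_add T_mult bij])
qed

theorem theorem1p1:
  fixes n :: nat
  assumes "card (UNIV :: 'a::ai_semiring set) = 2" and "n \<ge> 2"
  shows "finitely_based (mat_alg n :: 'a mat alg) \<longleftrightarrow> \<not> is_distributive_lattice TYPE('a)"
proof -
  obtain T :: "'a \<Rightarrow> bool" and m where T: "\<And>x y. T (x + y) = (T x \<or> T y)"
      "\<And>x y. T (x * y) = m (T x) (T y)" "bij T"
    and m: "m \<in> {\<lambda>_ _. False, \<lambda>_ _. True, \<lambda>p q. p, \<lambda>p q. q, (\<or>), (\<and>)}"
    and d: "is_distributive_lattice TYPE('a) \<longleftrightarrow> m = (\<and>)"
    by (rule two_element_ai_semiring[OF assms(1)]) (rule that)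
  have n: "n \<ge> 1"
    using assms(2) by simp
  have "bool_finitely_based m n \<longleftrightarrow> m \<noteq> (\<and>)"
  proof (cases "m = (\<and>)")
    case True
    then show ?thesis
      using conj_not_finitely_based[OF assms(2)] by simp
  next
    case False
    then have "m \<in> {\<lambda>_ _. False, \<lambda>_ _. True, \<lambda>p q. p, \<lambda>p q. q, (\<or>)}"
      using m by blast
    then have "bool_finitely_based m n"
      using False_finitely_based[OF n] True_finitely_based[OF n] left_finitely_based[OF assms(2)]
        right_finitely_based[OF assms(2)] disj_finitely_based[OF assms(2)]
      by (elim insertE emptyE) simp_all
    then show ?thesis
      using False by simp
  qed
  then show ?thesis
    using finitely_based_mat_alg_iff[of T m n, OF T n] d by simp
qed

end
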